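(* Let $\boldsymbol\beta(z)=\sum_{j\in\mathbb Z}\beta_jz^{-j-1}\in M^*[[z^{-1},z]]$. For all $m\in\mathbb Z$ and all partitions $\lambda$, $$\boldsymbol\beta(z)\lrcorner[\mathbf b]_{m+\lambda}=z^{-1}R(z)^{-1}\,\overline\sigma_+(z)\,\sigma_-(z)\,[\mathbf b]_{m+\lambda}=z^{-1}R(z)^{-1}E(z)\,\sigma_-(z)\,[\mathbf b]_{m+\lambda}.$$
   Context: Exterior algebra and Schubert derivations. $M=\bigoplus_{i\in\mathbb Z}\mathbb Z b_i$ is a free abelian group with basis $(b_i)_{i\in\mathbb Z}$, $\bigwedge M$ its exterior algebra over $\mathbb Z$. A Hasse–Schmidt (HS) derivation on $\bigwedge M$ is a $\mathbb Z$-linear map $\mathcal D(z):\bigwedge M\to\bigwedge M[[z]]$ (or $\bigwedge M[[z^{-1}]]$) with $\mathcal D(z)(u\wedge v)=\mathcal D(z)u\wedge\mathcal D(z)v$. $\sigma_\pm(z)=\sum_{i\ge0}\sigma_{\pm i}z^{\pm i}$ are the unique HS derivations with $\sigma_\pm(z)b_j=\sum_{i\ge0}b_{j\pm i}z^{\pm i}$; $\overline\sigma_+(z)$, the formal inverse of $\sigma_+(z)$, is the unique HS derivation with $\overline\sigma_+(z)b_j=b_j-b_{j+1}z$. Fermionic Fock space. $\mathcal P$ is the set of partitions, $\mathcal P_r$ those of length $\ell(\lambda)\le r$. For $\lambda\in\mathcal P_r$, $\mathbf b^r_{m+\lambda}:=b_{m+\lambda_1}\wedge b_{m-1+\lambda_2}\wedge\cdots\wedge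 b_{m-r+1+\lambda_r}$. Let $[M]$ be the free $\mathbb Z$-module with basis $([\mathbf b]_m)_{m\in\mathbb Z}$, and $F:=(\bigwedge M\otimes_{\mathbb Z}[M])/W$ where $W$ is the $\bigwedge M$-submodule generated by all $b_m\otimes[\mathbf b]_{m-1}-1\otimes[\mathbf b]_m$ and $b_m\otimes[\mathbf b]_m$, $m\in\mathbb Z$. The class of $u\otimes[\mathbf b]_m$ is written $u\wedge[\mathbf b]_m$. Put $[\mathbf b]_{m+\lambda}:=\mathbf b^r_{m+\lambda}\wedge[\mathbf b]_{m-r}$ for any $r\ge\ell(\lambda)$ (independent of $r$). Then $F=\bigoplus_m F_m$, $F_m=\bigoplus_{\lambda\in\mathcal P}\mathbb Z[\mathbf b]_{m+\lambda}$. Extension to $F$. Put $\sigma_+(z)[\mathbf b]_m=(\sigma_+(z)b_m)\wedge[\mathbf b]_{m-1}$, $\overline\sigma_+(z)[\mathbf b]_m=\sum_{j\ge0}(-1)^j[\mathbf b]_{m+(1^j)}z^j$, $\sigma_-(z)[\mathbf b]_m=[\mathbf b]_m$, and for each $\tau(z)\in\{\sigma_\pm(z),\overline\sigma_+(z)\}$ put $\tau(z)[\mathbf b]_{m+\lambda}=\tau(z)\mathbf b^r_{m+\lambda}\wedge\tau(z)[\mathbf b]_{m-r}$ ($r\ge\ell(\lambda)$), extended $\mathbb Z$-linearly. Compositions are right to left, applied coefficientwise. Contraction. $M^*=\bigoplus_j\mathbb Z\beta_j$ with $\beta_j(b_i)=\delta_{ij}$. For $u\in\bigwedge^rM$ and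 $\beta\in M^*$, $\beta\lrcorner u\in\bigwedge^{r-1}M$ is the unique vector with $\eta(\beta\lrcorner u)=(\beta\wedge\eta)(u)$ for all $\eta\in\bigwedge^{r-1}M^*$, where $(\beta_{i_1}\wedge\cdots\wedge\beta_{i_r})(b_{j_1}\wedge\cdots\wedge b_{j_r})=\det(\beta_{i_k}(b_{j_l}))$. On $F$: $\beta_j\lrcorner[\mathbf b]_{m+\lambda}:=(\beta_j\lrcorner\mathbf b^r_{m+\lambda})\wedge[\mathbf b]_{m-r}$ for any $r>\max(\ell(\lambda),m-j)$ (independent of $r$). $R(z)$ is the operator $R(z)[\mathbf b]_{m+\lambda}=z^{m+1}[\mathbf b]_{m+1+\lambda}$, with inverse $R(z)^{-1}[\mathbf b]_{m+\lambda}=z^{-m}[\mathbf b]_{m-1+\lambda}$, linear over $\mathbb Z[z,z^{-1}]$ and applied coefficientwise to formal series. $B=\mathbb Z[e_1,e_2,\ldots]$, $E(z)=1+\sum_{j\ge1}(-1)^je_jz^j$, $\sum_jh_jz^j=1/E(z)$. $F$ is a $B$-module via $h_iu=\sigma_iu$ ($i\ge0$), so that $\sigma_+(z)$ acts as multiplication by $1/E(z)$. *)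

theory Defs
  imports
    "HOL-Library.Poly_Mapping"
    "HOL-Computational_Algebra.Formal_Power_Series"
    "HOL-Computational_Algebra.Group_Closure"
    "Jordan_Normal_Form.Determinant"
begin

lemma group_closure_cong:
  fixes S :: "'a::ab_group_add set"
  shows group_closure_cong_sym: "x - y \<in> group_closure S \<Longrightarrow> y - x \<in> group_closure S"
    and group_closure_cong_trans:
      "x - y \<in> group_closure S \<Longrightarrow> y - z \<in> group_closure S \<Longrightarrow> x - z \<in> group_closure S"
    and group_closure_cong_uminus: "x - y \<in> group_closure S \<Longrightarrow> - x - - y \<in> group_closure S"
    and group_closure_cong_add: "x - y \<in> group_closure S \<Longrightarrow> x' - y' \<in> group_closure S
      \<Longrightarrow> x + x' - (y + y') \<in> group_closure S"
    and group_closure_cong_diff: "x - y \<in> group_closure S \<Longrightarrow> x' - y' \<in> group_closure S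
      \<Longrightarrow> x - x' - (y - y') \<in> group_closure S"
  using group_closure_minus_iff[of "x - y" S] group_closure_add[of "x - y" S "y - z"]
    group_closure_add[of "x - y" S "x' - y'"] group_closure.diff[of "x - y" S "x' - y'"]
  by (simp_all add: algebra_simps)

section \<open>The exterior algebra of a free abelian group\<close>

text \<open>
  Words form the free monoid, written additively so that \<^typ>\<open>'b \<Rightarrow>\<^sub>0 int\<close> over it is a ring
  with the convolution product: this is the tensor algebra of the free abelian group on \<open>'a\<close>.
\<close>

datatype 'a fword = FWord (letters: "'a list")

instantiation fword :: (type) monoid_add
begin
definition "0 = FWord []"
definition "v + w = FWord (letters v @ letters w)"
instance by standard (simp_all add: zero_fword_def plus_fword_def)
end

type_synonym 'a tensor_alg = "'a fword \<Rightarrow>\<^sub>0 int"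

definition letter :: "'a \<Rightarrow> 'a tensor_alg" where
  "letter i = Poly_Mapping.single (FWord [i]) 1"

definition alt_ideal :: "'a tensor_alg set" where
  "alt_ideal = group_closure {x * (v * v) * y | x v y. v \<in> group_closure (range letter)}"

lemma alt_ideal_mult:
  assumes "w \<in> alt_ideal" shows "x * w \<in> alt_ideal" "w * x \<in> alt_ideal"
proof -
  let ?S = "{x * (v * v) * y | x v y. v \<in> group_closure (range (letter :: 'a \<Rightarrow> _))}"
  have "x * w \<in> group_closure ?S \<and> w * x \<in> group_closure ?S"
    using assms unfolding alt_ideal_def
  proof (induction rule: group_closure.induct)
    case (base s)
    then show ?case
    proof (cases "s = 0")
      case False
      with base obtain a v b where s: "s = a * (v * v) * b" and v: "v \<in> group_closure (range letter)"
        by auto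
      have "x * s = (x * a) * (v * v) * b" "s * x = a * (v * v) * (b * x)"
        by (simp_all add: s mult.assoc)
      with v show ?thesis by (blast intro: group_closure.base)
    qed simp
  next
    case (diff s t)
    then show ?case by (simp add: algebra_simps group_closure.diff)
  qed
  then show "x * w \<in> alt_ideal" "w * x \<in> alt_ideal" by (simp_all add: alt_ideal_def)
qed

lemma lookup_mult_empty:
  fixes x y :: "'a tensor_alg"
  shows "poly_mapping.lookup (x * y) 0 = poly_mapping.lookup x 0 * poly_mapping.lookup y 0"
proof -
  have *: "(0 = l + q) \<longleftrightarrow> l = 0 \<and> q = 0" for l q :: "'a fword"
    by (cases l; cases q) (auto simp: zero_fword_def plus_fword_def)
  have "Sum_any (\<lambda>q. poly_mapping.lookup y q when (0 = l + q)) =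
      (poly_mapping.lookup y 0 when l = 0)" for l
    unfolding * by (cases "l = 0") (simp_all add: when_def)
  then have "poly_mapping.lookup (x * y) 0 =
      Sum_any (\<lambda>l. poly_mapping.lookup x l * (poly_mapping.lookup y 0 when l = 0))"
    by (simp add: lookup_mult)
  also have "\<dots> = Sum_any (\<lambda>l. (poly_mapping.lookup x l * poly_mapping.lookup y 0) when l = 0)"
    by (rule Sum_any.cong) (simp add: when_def)
  finally show ?thesis by simp
qed

lemma lookup_alt_ideal: "w \<in> alt_ideal \<Longrightarrow> poly_mapping.lookup w 0 = 0"
proof -
  have v: "poly_mapping.lookup v 0 = 0" if "v \<in> group_closure (range letter)" for v :: "'a tensor_alg"
    using that
    by (induction rule: group_closure.induct)
       (auto simp: letter_def lookup_single lookup_minus zero_fword_def)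
  show "w \<in> alt_ideal \<Longrightarrow> poly_mapping.lookup w 0 = 0" unfolding alt_ideal_def
    by (induction rule: group_closure.induct) (auto simp: lookup_mult_empty v lookup_minus)
qed

quotient_type 'a ext = "'a tensor_alg" / "\<lambda>x y. x - y \<in> alt_ideal"
  morphisms rep_ext ext_of
proof (rule equivpI)
  show "reflp (\<lambda>x y. x - y \<in> (alt_ideal :: 'a tensor_alg set))"
    by (rule reflpI) (simp add: alt_ideal_def)
  show "symp (\<lambda>x y. x - y \<in> (alt_ideal :: 'a tensor_alg set))"
    unfolding alt_ideal_def by (rule sympI) (rule group_closure_cong_sym)
  show "transp (\<lambda>x y. x - y \<in> (alt_ideal :: 'a tensor_alg set))"
    unfolding alt_ideal_def by (rule transpI) (rule group_closure_cong_trans)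
qed

text \<open>Multiplication in \<^typ>\<open>'a ext\<close> is the wedge product.\<close>

instantiation ext :: (type) ring_1
begin

lift_definition zero_ext :: "'a ext" is 0 .
lift_definition one_ext :: "'a ext" is 1 .

lift_definition plus_ext :: "'a ext \<Rightarrow> 'a ext \<Rightarrow> 'a ext" is "(+)"
  unfolding alt_ideal_def by (rule group_closure_cong_add)

lift_definition uminus_ext :: "'a ext \<Rightarrow> 'a ext" is uminus
  unfolding alt_ideal_def by (rule group_closure_cong_uminus)

lift_definition minus_ext :: "'a ext \<Rightarrow> 'a ext \<Rightarrow> 'a ext" is "(-)"
  unfolding alt_ideal_def by (rule group_closure_cong_diff)

lift_definition times_ext :: "'a ext \<Rightarrow> 'a ext \<Rightarrow> 'a ext" is "(*)"
proof -
  fix x x' y y' :: "'a tensor_alg"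
  assume "x - x' \<in> alt_ideal" "y - y' \<in> alt_ideal"
  then have "(x - x') * y \<in> alt_ideal" "x' * (y - y') \<in> alt_ideal"
    by (simp_all add: alt_ideal_mult)
  then have "(x - x') * y + x' * (y - y') \<in> alt_ideal"
    unfolding alt_ideal_def by (rule group_closure_add)
  then show "x * y - x' * y' \<in> alt_ideal" by (simp add: algebra_simps)
qed

instance
proof
  have [simp]: "0 \<in> (alt_ideal :: 'a tensor_alg set)" by (simp add: alt_ideal_def)
  fix a b c :: "'a ext"
  show "a + b + c = a + (b + c)" by transfer (simp add: algebra_simps)
  show "a + b = b + a" by transfer (simp add: algebra_simps)
  show "0 + a = a" by transfer simp
  show "- a + a = 0" by transfer simp
  show "a - b = a + - b" by transfer simp
  show "a * b * c = a * (b * c)" by transfer (simp add: algebra_simps)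
  show "1 * a = a" by transfer simp
  show "a * 1 = a" by transfer simp
  show "(a + b) * c = a * c + b * c" by transfer (simp add: algebra_simps)
  show "a * (b + c) = a * b + a * c" by transfer (simp add: algebra_simps)
  show "(0 :: 'a ext) \<noteq> 1"
  proof (transfer, rule notI)
    assume "0 - 1 \<in> (alt_ideal :: 'a tensor_alg set)"
    from lookup_alt_ideal[OF this] show False by (simp add: lookup_minus lookup_one)
  qed
qed

end

lift_definition gen :: "'a \<Rightarrow> 'a ext" is letter .

definition gens :: "'a list \<Rightarrow> 'a ext" where
  "gens is = prod_list (map gen is)"

definition ext_power :: "nat \<Rightarrow> 'a ext set" where
  "ext_power r = group_closure {gens is | is. length is = r}"

section \<open>Hasse--Schmidt derivations\<close>

text \<open>
  The basis vector \<open>b\<^sub>i\<close> of \<open>M\<close> is \<^term>\<open>gen i :: int ext\<close>. Additive maps between abelian groups are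
  the \<open>\<int>\<close>-linear ones. The variable of \<^typ>\<open>int ext fps\<close> is read as \<open>z\<close> or as \<open>z\<^sup>-\<^sup>1\<close>, the latter for
  \<open>sigma_minus\<close>.
\<close>

definition hs_derivation :: "(int ext \<Rightarrow> int ext fps) \<Rightarrow> bool" where
  "hs_derivation D \<longleftrightarrow> Modules.additive D \<and> (\<forall>u v. D (u * v) = D u * D v)"

definition sigma_plus :: "int ext \<Rightarrow> int ext fps" where
  "sigma_plus = (THE D. hs_derivation D \<and> (\<forall>j. D (gen j) = Abs_fps (\<lambda>i. gen (j + int i))))"

definition sigma_minus :: "int ext \<Rightarrow> int ext fps" where
  "sigma_minus = (THE D. hs_derivation D \<and> (\<forall>j. D (gen j) = Abs_fps (\<lambda>i. gen (j - int i))))"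

definition sigma_plus_bar :: "int ext \<Rightarrow> int ext fps" where
  "sigma_plus_bar = (THE D. hs_derivation D \<and>
     (\<forall>j. D (gen j) = fps_const (gen j) - fps_const (gen (j + 1)) * fps_X))"

section \<open>Contraction on the exterior algebra\<close>

text \<open>
  \<open>M\<^sup>*\<close> is free on the \<open>\<beta>\<^sub>j\<close>, so its exterior algebra is again \<^typ>\<open>int ext\<close>, with
  \<^term>\<open>gen j\<close> now standing for \<open>\<beta>\<^sub>j\<close>. The first argument of the pairing lives there.
\<close>

definition ext_pairing :: "int ext \<Rightarrow> int ext \<Rightarrow> int" where
  "ext_pairing = (THE p. (\<forall>\<eta>. Modules.additive (p \<eta>)) \<and> (\<forall>u. Modules.additive (\<lambda>\<eta>. p \<eta> u)) \<and>
     (\<forall>is js. p (gens is) (gens js) =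
        (if length is = length js
         then det (mat (length is) (length is) (\<lambda>(k, l). if is ! k = js ! l then 1 else 0))
         else 0)))"

text \<open>Meaningful for \<open>r \<ge> 1\<close>, \<open>\<beta> \<in> M\<^sup>*\<close> and \<open>u\<close> of degree \<open>r\<close>.\<close>

definition contract :: "nat \<Rightarrow> int ext \<Rightarrow> int ext \<Rightarrow> int ext" where
  "contract r \<beta> u = (THE v. v \<in> ext_power (r - 1) \<and>
     (\<forall>\<eta> \<in> ext_power (r - 1). ext_pairing \<eta> v = ext_pairing (\<beta> * \<eta>) u))"

section \<open>The fermionic Fock space\<close>

text \<open>
  \<open>[M]\<close> is free on the symbols \<open>[b]\<^sub>m\<close>, so \<open>\<And>M \<otimes> [M]\<close> is a direct sum of copies of \<open>\<And>M\<close>, and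
  \<open>u \<otimes> [b]\<^sub>m\<close> is \<^term>\<open>Poly_Mapping.single m u\<close>.
\<close>

type_synonym pre_fock = "int \<Rightarrow>\<^sub>0 int ext"

definition pre_scale :: "int ext \<Rightarrow> pre_fock \<Rightarrow> pre_fock" where
  "pre_scale u = Poly_Mapping.map ((*) u)"

lemma lookup_pre_scale: "poly_mapping.lookup (pre_scale u x) k = u * poly_mapping.lookup x k"
  by (simp add: pre_scale_def map.rep_eq when_def)

lemma pre_scale_simps:
  "pre_scale u (x + y) = pre_scale u x + pre_scale u y"
  "pre_scale u (x - y) = pre_scale u x - pre_scale u y"
  "pre_scale (u + v) x = pre_scale u x + pre_scale v x"
  "pre_scale (u - v) x = pre_scale u x - pre_scale v x"
  "pre_scale (u * v) x = pre_scale u (pre_scale v x)"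
  "pre_scale 1 x = x"
  "pre_scale u 0 = 0"
  "pre_scale u (Poly_Mapping.single m v) = Poly_Mapping.single m (u * v)"
  by (rule poly_mapping_eqI;
      simp add: lookup_pre_scale lookup_add lookup_minus lookup_single when_def algebra_simps)+

definition fock_rel_gens :: "pre_fock set" where
  "fock_rel_gens =
     (\<Union>m. {Poly_Mapping.single (m - 1) (gen m) - Poly_Mapping.single m 1,
           Poly_Mapping.single m (gen m)})"

definition fock_rel :: "pre_fock set" where
  "fock_rel = group_closure {pre_scale u g | u g. g \<in> fock_rel_gens}"

lemma fock_rel_scale: "w \<in> fock_rel \<Longrightarrow> pre_scale u w \<in> fock_rel"
  unfolding fock_rel_def
proof (induction rule: group_closure.induct)
  case (base s)
  then show ?case
  proof (cases "s = 0")
    case False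
    with base obtain v g where "s = pre_scale v g" "g \<in> fock_rel_gens" by auto
    then have "pre_scale u s = pre_scale (u * v) g" by (simp add: pre_scale_simps)
    with \<open>g \<in> fock_rel_gens\<close> show ?thesis by (blast intro: group_closure.base)
  qed (simp add: pre_scale_simps)
next
  case (diff s t)
  then show ?case by (simp add: pre_scale_simps group_closure.diff)
qed

quotient_type fock = pre_fock / "\<lambda>x y. x - y \<in> fock_rel"
  morphisms rep_fock fock_of
proof (rule equivpI)
  show "reflp (\<lambda>x y. x - y \<in> fock_rel)"
    by (rule reflpI) (simp add: fock_rel_def)
  show "symp (\<lambda>x y. x - y \<in> fock_rel)"
    unfolding fock_rel_def by (rule sympI) (rule group_closure_cong_sym)
  show "transp (\<lambda>x y. x - y \<in> fock_rel)"
    unfolding fock_rel_def by (rule transpI) (rule group_closure_cong_trans)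
qed

instantiation fock :: ab_group_add
begin

lift_definition zero_fock :: fock is 0 .

lift_definition plus_fock :: "fock \<Rightarrow> fock \<Rightarrow> fock" is "(+)"
  unfolding fock_rel_def by (rule group_closure_cong_add)

lift_definition uminus_fock :: "fock \<Rightarrow> fock" is uminus
  unfolding fock_rel_def by (rule group_closure_cong_uminus)

lift_definition minus_fock :: "fock \<Rightarrow> fock \<Rightarrow> fock" is "(-)"
  unfolding fock_rel_def by (rule group_closure_cong_diff)

instance
proof
  have [simp]: "0 \<in> fock_rel" by (simp add: fock_rel_def)
  fix a b c :: fock
  show "a + b + c = a + (b + c)" by transfer (simp add: algebra_simps)
  show "a + b = b + a" by transfer (simp add: algebra_simps)
  show "0 + a = a" by transfer simp
  show "- a + a = 0" by transfer simp
  show "a - b = a + - b" by transfer simp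
qed

end

lift_definition wedge :: "int ext \<Rightarrow> fock \<Rightarrow> fock" is pre_scale
  by (simp only: fock_rel_scale flip: pre_scale_simps(2))

text \<open>The class of \<open>1 \<otimes> [b]\<^sub>m\<close>.\<close>

lift_definition vac :: "int \<Rightarrow> fock" is "\<lambda>m. Poly_Mapping.single m 1" .

subsection \<open>The basis vectors indexed by partitions\<close>

definition is_partition :: "nat list \<Rightarrow> bool" where
  "is_partition lam \<longleftrightarrow> sorted_wrt (\<ge>) lam \<and> 0 \<notin> set lam"

text \<open>Parts are numbered from 0 and vanish beyond the length.\<close>

definition part :: "nat list \<Rightarrow> nat \<Rightarrow> nat" where
  "part lam i = (if i < length lam then lam ! i else 0)"

definition b_wedge :: "nat \<Rightarrow> int \<Rightarrow> nat list \<Rightarrow> int ext" where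
  "b_wedge r m lam = gens (map (\<lambda>i. m - int i + int (part lam i)) [0..<r])"

definition fock_basis :: "int \<Rightarrow> nat list \<Rightarrow> fock" where
  "fock_basis m lam = wedge (b_wedge (length lam) m lam) (vac (m - int (length lam)))"

lemma wedge_mult: "wedge (u * v) x = wedge u (wedge v x)"
proof -
  have [simp]: "0 \<in> fock_rel" by (simp add: fock_rel_def)
  show ?thesis by transfer (simp add: pre_scale_simps)
qed

lemma wedge_gen_vac: "wedge (gen m) (vac (m - 1)) = vac m" "wedge (gen m) (vac m) = 0"
proof -
  have 1: "g \<in> fock_rel" if "g \<in> fock_rel_gens" for g
  proof -
    have "g = pre_scale 1 g" by (simp add: pre_scale_simps)
    with that show ?thesis unfolding fock_rel_def by (blast intro: group_closure.base)
  qed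
  show "wedge (gen m) (vac (m - 1)) = vac m"
    by (transfer, rule 1) (auto simp: fock_rel_gens_def pre_scale_simps)
  show "wedge (gen m) (vac m) = 0"
    by (transfer, rule 1) (auto simp: fock_rel_gens_def pre_scale_simps)
qed

lemma fock_basis_eq:
  assumes "length lam \<le> r"
  shows "fock_basis m lam = wedge (b_wedge r m lam) (vac (m - int r))"
  using assms
proof (induction r rule: dec_induct)
  case base
  show ?case by (simp add: fock_basis_def)
next
  case (step r)
  have "b_wedge (Suc r) m lam = b_wedge r m lam * gen (m - int r)"
    using step.hyps by (simp add: b_wedge_def gens_def part_def)
  with step.IH wedge_gen_vac(1)[of "m - int r"] show ?case
    by (simp add: wedge_mult algebra_simps)
qed

section \<open>Schubert derivations and contraction on the Fock space\<close>

definition wedge_fps :: "int ext fps \<Rightarrow> fock fps \<Rightarrow> fock fps" where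
  "wedge_fps p g = Abs_fps (\<lambda>n. \<Sum>i = 0..n. wedge (fps_nth p i) (fps_nth g (n - i)))"

text \<open>
  The extension to \<open>F\<close> of a derivation \<open>D\<close> on \<open>\<And>M\<close> for which the images \<open>V m\<close> of the vectors
  \<open>[b]\<^sub>m\<close> are prescribed.
\<close>

definition fock_extension ::
  "(int ext \<Rightarrow> int ext fps) \<Rightarrow> (int \<Rightarrow> fock fps) \<Rightarrow> fock \<Rightarrow> fock fps" where
  "fock_extension D V = (THE T. Modules.additive T \<and>
     (\<forall>m lam r. is_partition lam \<longrightarrow> length lam \<le> r \<longrightarrow>
        T (fock_basis m lam) = wedge_fps (D (b_wedge r m lam)) (V (m - int r))))"

definition fock_sigma_plus :: "fock \<Rightarrow> fock fps" where
  "fock_sigma_plus = fock_extension sigma_plus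
     (\<lambda>m. wedge_fps (sigma_plus (gen m)) (fps_const (vac (m - 1))))"

definition fock_sigma_plus_bar :: "fock \<Rightarrow> fock fps" where
  "fock_sigma_plus_bar = fock_extension sigma_plus_bar
     (\<lambda>m. Abs_fps (\<lambda>j. wedge ((-1) ^ j) (fock_basis m (replicate j 1))))"

text \<open>As for \<open>sigma_minus\<close>, the variable is \<open>z\<^sup>-\<^sup>1\<close>.\<close>

definition fock_sigma_minus :: "fock \<Rightarrow> fock fps" where
  "fock_sigma_minus = fock_extension sigma_minus (\<lambda>m. fps_const (vac m))"

definition fock_contract :: "int \<Rightarrow> fock \<Rightarrow> fock" where
  "fock_contract j = (THE C. Modules.additive C \<and>
     (\<forall>m lam r. is_partition lam \<longrightarrow> int r > max (int (length lam)) (m - j) \<longrightarrow>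
        C (fock_basis m lam) = wedge (contract r (gen j) (b_wedge r m lam)) (vac (m - int r))))"

section \<open>Formal series with coefficients in the Fock space\<close>

text \<open>
  An element of \<open>F[[z, z\<^sup>-\<^sup>1]]\<close> is a function on the integers; its value at \<open>n\<close> is the coefficient
  of \<open>z\<^sup>n\<close>.
\<close>

type_synonym fock_series = "int \<Rightarrow> fock"

definition series_z :: "fock fps \<Rightarrow> fock_series" where
  "series_z f n = (if n \<ge> 0 then fps_nth f (nat n) else 0)"

definition series_zinv :: "fock fps \<Rightarrow> fock_series" where
  "series_zinv f n = (if n \<le> 0 then fps_nth f (nat (- n)) else 0)"

definition z_power :: "int \<Rightarrow> fock_series \<Rightarrow> fock_series" where
  "z_power k f n = f (n - k)"

text \<open>
  The coefficientwise application of \<open>A\<close> to \<open>f = \<Sum>\<^sub>n f\<^sub>n z\<^sup>n\<close> is \<open>\<Sum>\<^sub>n A(f\<^sub>n) z\<^sup>n\<close>. Collecting powers of \<open>z\<close>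
  is legitimate when only finitely many terms contribute to each power; this is so for
  \<open>\<sigma>\<^sub>-(z) [b]\<^sub>m\<^sub>+\<^sub>\<lambda>\<close>, a polynomial in \<open>z\<^sup>-\<^sup>1\<close>, and for \<open>R(z)\<^sup>-\<^sup>1\<close> on series with coefficients in a single \<open>F\<^sub>m\<close>.
\<close>

definition apply_coeffwise :: "(fock \<Rightarrow> fock_series) \<Rightarrow> fock_series \<Rightarrow> fock_series" where
  "apply_coeffwise A f N = Sum_any (\<lambda>n. A (f n) (N - n))"

text \<open>The inverse of \<open>R(z)\<close>, on \<open>F\<close>; it is given by \<open>[b]\<^sub>m\<^sub>+\<^sub>\<lambda> \<mapsto> z\<^bsup>-m\<^esup> [b]\<^sub>m\<^sub>-\<^sub>1\<^sub>+\<^sub>\<lambda>\<close>.\<close>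

definition R_inv :: "fock \<Rightarrow> fock_series" where
  "R_inv = (THE A. (\<forall>n. Modules.additive (\<lambda>u. A u n)) \<and>
     (\<forall>m lam. is_partition lam \<longrightarrow>
        A (fock_basis m lam) = (\<lambda>n. if n = - m then fock_basis (m - 1) lam else 0)))"

text \<open>\<open>\<^bold>\<beta>(z) \<lrcorner> u = \<Sum>\<^sub>j (\<beta>\<^sub>j \<lrcorner> u) z\<^bsup>-j-1\<^esup>\<close>, so that the coefficient of \<open>z\<^sup>n\<close> comes from \<open>j = - n - 1\<close>.\<close>

definition beta_contract :: "fock \<Rightarrow> fock_series" where
  "beta_contract u n = fock_contract (- n - 1) u"

section \<open>The module structure over the ring of symmetric functions\<close>

text \<open>
  \<open>B = \<int>[e\<^sub>1, e\<^sub>2, \<dots>]\<close>: exponent vectors are finitely supported, and \<open>e\<^sub>j\<close> is the variable of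
  index \<open>j - 1\<close>.
\<close>

type_synonym B_ring = "(nat \<Rightarrow>\<^sub>0 nat) \<Rightarrow>\<^sub>0 int"

definition e_var :: "nat \<Rightarrow> B_ring" where
  "e_var j = Poly_Mapping.single (Poly_Mapping.single (j - 1) 1) 1"

definition E_series :: "B_ring fps" where
  "E_series = Abs_fps (\<lambda>j. if j = 0 then 1 else (-1) ^ j * e_var j)"

definition h_poly :: "nat \<Rightarrow> B_ring" where
  "h_poly i = fps_nth (fps_right_inverse E_series 1) i"

lemma h_poly_inverse: "E_series * Abs_fps h_poly = 1"
  unfolding h_poly_def fps_nth_inverse
  by (rule fps_right_inverse) (simp add: E_series_def)

text \<open>The action of \<open>B\<close> on \<open>F\<close> is determined by \<open>h\<^sub>i u = \<sigma>\<^sub>i u\<close>, since the \<open>h\<^sub>i\<close> generate \<open>B\<close>.\<close>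

definition B_act :: "B_ring \<Rightarrow> fock \<Rightarrow> fock" where
  "B_act = (THE s. Modules.module s \<and> (\<forall>i u. s (h_poly i) u = fps_nth (fock_sigma_plus u) i))"

definition E_act :: "fock \<Rightarrow> fock_series" where
  "E_act u = series_z (Abs_fps (\<lambda>j. B_act (fps_nth E_series j) u))"

end

theory Submission
  imports Defs
begin

text \<open>
  Contraction with \<open>\<beta>\<^sub>j\<close> is the unique operator \<open>\<Xi>\<^sub>j\<close> on \<open>F\<close> with \<open>\<Xi>\<^sub>j(b\<^sub>i \<and> x) = \<delta>\<^sub>i\<^sub>j x - b\<^sub>i \<and> \<Xi>\<^sub>j(x)\<close> that
  kills \<open>[b]\<^sub>m\<close> for \<open>m < j\<close>, so the coefficients of the right-hand side have to satisfy the same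
  relation. Let \<open>\<Gamma>(x)\<close> be the image of \<open>x\<close> under \<open>\<sigma>\<^sub>-(z)\<close> followed by the inverse of \<open>\<sigma>\<^sub>+(z)\<close>, and
  \<open>\<Delta>\<^sub>i(x) = \<Gamma>(b\<^sub>i \<and> x) + z b\<^sub>i\<^sub>+\<^sub>1 \<and> \<Gamma>(x)\<close>. From \<open>\<sigma>\<^sub>-(z) b\<^sub>i = b\<^sub>i + z\<^sup>-\<^sup>1 \<sigma>\<^sub>-(z) b\<^sub>i\<^sub>-\<^sub>1\<close> one gets
  \<open>\<Delta>\<^sub>i = z\<^sup>-\<^sup>1 \<Delta>\<^sub>i\<^sub>-\<^sub>1\<close>, and antisymmetry of the wedge product gives
  \<open>\<Delta>\<^sub>i(b\<^sub>k \<and> x) + \<Delta>\<^sub>k(b\<^sub>i \<and> x) = z b\<^sub>k\<^sub>+\<^sub>1 \<and> \<Delta>\<^sub>i(x) + z b\<^sub>i\<^sub>+\<^sub>1 \<and> \<Delta>\<^sub>k(x)\<close>. Since \<open>b\<^sub>i \<and> x = 0\<close> for \<open>i\<close> small enough,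
  these two facts determine \<open>\<Delta>\<^sub>i\<close> by induction from the vacuum: it is a power of \<open>z\<close> times
  the index shift that \<open>R(z)\<^sup>-\<^sup>1\<close> undoes.

  The Fock space is only used through maps out of it (which are given on all \<open>u \<and> [b]\<^sub>m\<close>, compatibly
  with the relations) and through its spanning set; linear independence of the \<open>[b]\<^sub>m\<^sub>+\<^sub>\<lambda>\<close> is
  never needed. The coefficients of the inverse of \<open>\<sigma>\<^sub>+(z)\<close> commute with one another, since their
  commutators are seen to annihilate the vacua, so they define the action of \<open>B\<close>.
\<close>

section \<open>Additive maps out of the exterior algebra\<close>

text \<open>The multiple \<open>n x\<close> in an arbitrary abelian group; at most one of the two
  sums is nonempty.\<close>

definition int_scale :: "int \<Rightarrow> 'b::ab_group_add \<Rightarrow> 'b" where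
  "int_scale n x = (\<Sum>i<nat n. x) - (\<Sum>i<nat (- n). x)"

lemma sum_const_lessThan_add: "(\<Sum>i<p + q. x) = (\<Sum>i<p. x) + (\<Sum>i<(q :: nat). (x :: 'b::ab_group_add))"
  by (induction q) (simp_all add: algebra_simps)

lemma int_scale_of_nat_diff: "int_scale (int a - int b) x = (\<Sum>i<a. x) - (\<Sum>i<b. x)"
proof (cases "b \<le> a")
  case True
  then obtain c where "a = b + c" using le_Suc_ex by blast
  then show ?thesis by (simp add: int_scale_def sum_const_lessThan_add)
next
  case False
  then obtain c where "b = a + c" using le_Suc_ex nat_le_linear by blast
  then show ?thesis by (simp add: int_scale_def sum_const_lessThan_add)
qed

lemma int_scale_simps [simp]:
  "int_scale 0 x = 0"
  "int_scale 1 x = x"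
  "int_scale (m + n) x = int_scale m x + int_scale n x"
proof -
  obtain a b where m: "m = int a - int b" by (rule int_diff_cases)
  obtain c d where n: "n = int c - int d" by (rule int_diff_cases)
  have "m + n = int (a + c) - int (b + d)" by (simp add: m n)
  then have "int_scale (m + n) x = (\<Sum>i<a + c. x) - (\<Sum>i<b + d. x)"
    by (simp only: int_scale_of_nat_diff)
  then show "int_scale (m + n) x = int_scale m x + int_scale n x"
    by (simp only: m n int_scale_of_nat_diff sum_const_lessThan_add) simp
qed (simp_all add: int_scale_def)

definition linear_ext :: "('k \<Rightarrow> 'b::ab_group_add) \<Rightarrow> ('k \<Rightarrow>\<^sub>0 int) \<Rightarrow> 'b" where
  "linear_ext g x = (\<Sum>k\<in>Poly_Mapping.keys x. int_scale (Poly_Mapping.lookup x k) (g k))"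

lemma additive_linear_ext: "Modules.additive (linear_ext g)"
  by (rule Modules.additive.intro)
     (simp add: linear_ext_def setsum_keys_plus_distrib[of "\<lambda>k n. int_scale n (g k)"])

lemma linear_ext_single [simp]: "linear_ext g (Poly_Mapping.single k 1) = g k"
  by (simp add: linear_ext_def)

text \<open>Basis vectors generate a free abelian group under subtraction alone; zero arises as a
  basis vector minus itself.\<close>

lemma frag_induct [case_names single diff]:
  assumes "\<And>k. P (Poly_Mapping.single k 1)" "\<And>x y. P x \<Longrightarrow> P y \<Longrightarrow> P (x - y)"
  shows "P (x :: 'k \<Rightarrow>\<^sub>0 int)"
proof -
  have "P 0" using assms(1)[of undefined] assms(2) by (metis diff_self)
  then show ?thesis
    using frag_induction[of x UNIV P] assms by blast
qed

lemma single_plus_fword: "Poly_Mapping.single (FWord xs) 1 * Poly_Mapping.single (FWord ys) 1 =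
    (Poly_Mapping.single (FWord (xs @ ys)) 1 :: 'a tensor_alg)"
  by (simp add: mult_single plus_fword_def)

lemma gens_simps [simp]:
  "gens [] = 1" "gens (x # xs) = gen x * gens xs" "gens (xs @ ys) = gens xs * gens ys"
  by (simp_all add: gens_def)

lemma gens_eq_ext_of: "gens xs = ext_of (Poly_Mapping.single (FWord xs) 1)"
proof (induction xs)
  case Nil
  have "(1 :: 'a tensor_alg) = Poly_Mapping.single (FWord []) 1"
    by (simp flip: zero_fword_def)
  then show ?case by (simp only: gens_simps(1) one_ext.abs_eq)
next
  case (Cons x xs)
  have "gen x = ext_of (letter x)" by (simp add: gen.abs_eq)
  then show ?case
    by (simp add: Cons times_ext.abs_eq letter_def single_plus_fword)
qed

lemma ext_induct [case_names gens diff]: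
  assumes "\<And>xs. P (gens xs)" "\<And>u v. P u \<Longrightarrow> P v \<Longrightarrow> P (u - v)"
  shows "P u"
proof -
  obtain x where u: "u = ext_of x" by (metis Quotient_ext Quotient_abs_rep)
  show ?thesis unfolding u
  proof (induction x rule: frag_induct)
    case (single k)
    then show ?case using assms(1)[of "letters k"] by (simp add: gens_eq_ext_of)
  next
    case (diff x y)
    then show ?case using assms(2) by (simp flip: minus_ext.abs_eq)
  qed
qed

text \<open>The relations that \<open>alt_ideal\<close> imposes on words. The first clause is
  separate because the second, for equal letters, only says that twice the value is zero, and the
  target may have 2-torsion.\<close>

definition alternating :: "('a list \<Rightarrow> 'b::ab_group_add) \<Rightarrow> bool" where
  "alternating g \<longleftrightarrow> (\<forall>xs ys i. g (xs @ i # i # ys) = 0) \<and>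
     (\<forall>xs ys i j. g (xs @ i # j # ys) + g (xs @ j # i # ys) = 0)"

definition ext_lift :: "('a list \<Rightarrow> 'b::ab_group_add) \<Rightarrow> 'a ext \<Rightarrow> 'b" where
  "ext_lift g = (THE G. Modules.additive G \<and> (\<forall>xs. G (gens xs) = g xs))"

lemma additive_eqI_ext:
  assumes "Modules.additive G" "Modules.additive H" "\<And>xs. G (gens xs) = H (gens xs)"
  shows "G u = H u"
  by (induction u rule: ext_induct) (simp_all add: assms Modules.additive.diff)

text \<open>The linear extension to the tensor algebra kills \<open>alt_ideal\<close>: expanding the
  square of a difference leaves squares and a symmetrised product, so closure under subtraction
  reduces everything to letters, where \<open>alternating\<close> applies.\<close>

lemma ext_lift_exists:
  fixes g :: "'a list \<Rightarrow> 'b::ab_group_add"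
  assumes "alternating g"
  shows "\<exists>G. Modules.additive G \<and> (\<forall>xs. G (gens xs) = g xs)"
proof -
  define L :: "'a tensor_alg \<Rightarrow> 'b" where "L = linear_ext (\<lambda>w. g (letters w))"
  interpret L: Modules.additive L unfolding L_def by (rule additive_linear_ext)
  let ?w = "\<lambda>xs. Poly_Mapping.single (FWord xs) 1 :: 'a tensor_alg"
  let ?M = "group_closure (range letter) :: 'a tensor_alg set"
  have L_word [simp]: "L (?w xs) = g xs" for xs by (simp add: L_def)
  have word: "?w p * (letter i * letter j) * ?w q = ?w (p @ i # j # q)" for p q i j
    by (simp add: letter_def single_plus_fword)
  have anti1: "L (?w p * (letter i * v + v * letter i) * ?w q) = 0" if "v \<in> ?M" for p q v i
    using that
  proof (induction rule: group_closure.induct)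
    case (base s)
    then show ?case
      using assms by (auto simp: word L.zero L.add distrib_left distrib_right alternating_def)
  next
    case (diff s t)
    have "?w p * (letter i * (s - t) + (s - t) * letter i) * ?w q =
      ?w p * (letter i * s + s * letter i) * ?w q - ?w p * (letter i * t + t * letter i) * ?w q"
      by (simp add: algebra_simps)
    then show ?case using diff by (simp add: L.diff)
  qed
  have anti: "L (?w p * (u * v + v * u) * ?w q) = 0" if "u \<in> ?M" "v \<in> ?M" for p q u v
    using that
  proof (induction rule: group_closure.induct)
    case (base s)
    then show ?case by (auto simp: L.zero anti1)
  next
    case (diff s t)
    have "?w p * ((s - t) * v + v * (s - t)) * ?w q =
      ?w p * (s * v + v * s) * ?w q - ?w p * (t * v + v * t) * ?w q"
      by (simp add: algebra_simps)
    then show ?case using diff by (simp add: L.diff)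
  qed
  have square: "L (?w p * (v * v) * ?w q) = 0" if "v \<in> ?M" for p q v
    using that
  proof (induction rule: group_closure.induct)
    case (base s)
    then show ?case using assms by (auto simp: word L.zero alternating_def)
  next
    case (diff s t)
    have "?w p * ((s - t) * (s - t)) * ?w q = ?w p * (s * s) * ?w q
       - ?w p * (s * t + t * s) * ?w q + ?w p * (t * t) * ?w q"
      by (simp add: algebra_simps)
    then show ?case using diff anti by (simp add: L.diff L.add)
  qed
  have square': "L (x * (v * v) * y) = 0" if v: "v \<in> ?M" for x y v
  proof -
    have "L (?w p * (v * v) * y) = 0" for p
    proof (induction y rule: frag_induct)
      case (single k)
      show ?case using square[OF v, of p "letters k"] by simp
    qed (simp add: right_diff_distrib L.diff)
    then have *: "L (Poly_Mapping.single k 1 * (v * v) * y) = 0" for k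
      by (metis fword.collapse)
    show ?thesis
    proof (induction x rule: frag_induct)
      case (single k)
      show ?case by (rule *)
    qed (simp add: left_diff_distrib L.diff)
  qed
  have kills: "L w = 0" if "w \<in> alt_ideal" for w
    using that unfolding alt_ideal_def
    by (induction rule: group_closure.induct) (auto simp: square' L.zero L.diff)
  define G where "G u = L (rep_ext u)" for u
  have G: "G (ext_of x) = L x" for x
  proof -
    have "rep_ext (ext_of x) - x \<in> alt_ideal"
      by (rule Quotient_rep_abs[OF Quotient_ext]) (simp add: alt_ideal_def)
    then have "L (rep_ext (ext_of x) - x) = 0" by (rule kills)
    then show ?thesis by (simp add: G_def L.diff)
  qed
  have "G (u + v) = G u + G v" for u v
  proof -
    obtain x y where "u = ext_of x" "v = ext_of y" by (metis Quotient_ext Quotient_abs_rep)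
    then show ?thesis by (simp add: plus_ext.abs_eq G L.add)
  qed
  then have "Modules.additive G" by (rule Modules.additive.intro)
  moreover have "G (gens xs) = g xs" for xs by (simp add: gens_eq_ext_of G)
  ultimately show ?thesis by blast
qed

lemma ext_lift:
  assumes "alternating g"
  shows additive_ext_lift: "Modules.additive (ext_lift g)"
    and ext_lift_gens: "ext_lift g (gens xs) = g xs"
proof -
  have "\<exists>!G. Modules.additive G \<and> (\<forall>xs. G (gens xs) = g xs)"
    using ext_lift_exists[OF assms] by (rule ex_ex1I) (metis additive_eqI_ext ext)
  from theI'[OF this] show "Modules.additive (ext_lift g)" "ext_lift g (gens xs) = g xs"
    by (simp_all add: ext_lift_def)
qed

section \<open>Relations between the generators of the exterior algebra\<close>

lemma gen_square [simp]: "gen i * gen i = 0"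
proof (transfer)
  fix i :: 'a
  have "1 * (letter i * letter i) * 1 \<in> alt_ideal"
    unfolding alt_ideal_def by (intro group_closure.base insertI2) (blast intro: group_closure.base)
  then show "letter i * letter i - 0 \<in> alt_ideal" by simp
qed

lemma gen_anticomm: "gen i * gen j = - (gen j * gen i :: 'a ext)"
proof -
  have "(gen i + gen j) * (gen i + gen j) = (0 :: 'a ext)"
  proof (transfer)
    fix i j :: 'a
    have "letter i + letter j \<in> group_closure (range letter)"
      by (intro group_closure_add group_closure.base) auto
    then have "1 * ((letter i + letter j) * (letter i + letter j)) * 1 \<in> alt_ideal"
      unfolding alt_ideal_def by (intro group_closure.base insertI2) blast
    then show "(letter i + letter j) * (letter i + letter j) - 0 \<in> alt_ideal" by simp
  qed
  then show ?thesis by (simp add: algebra_simps eq_neg_iff_add_eq_0)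
qed

lemma gen_square_left [simp]: "gen i * (gen i * u) = 0"
  by (simp flip: mult.assoc)

lemma gen_anticomm_left: "gen i * (gen j * u) = - (gen j * (gen i * u))"
  by (simp add: gen_anticomm[of i j] flip: mult.assoc)

lemma gen_gens_comm: "gen i * gens xs = (-1) ^ length xs * (gens xs * gen i)"
proof (induction xs)
  case (Cons x xs)
  have "gen i * gens (x # xs) = - (gen x * (gen i * gens xs))"
    using gen_anticomm_left[of i x "gens xs"] by simp
  also have "\<dots> = - (gen x * ((-1) ^ length xs * (gens xs * gen i)))"
    by (simp only: Cons)
  also have "\<dots> = (-1) ^ length (x # xs) * (gens (x # xs) * gen i)"
    by (cases "even (length xs)") (simp_all add: mult.assoc)
  finally show ?case .
qed simp

text \<open>Carrying one copy of the repeated letter up to the other costs only a sign and produces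
  a square.\<close>

lemma gens_not_distinct:
  assumes "\<not> distinct xs"
  shows "gens xs = 0"
proof -
  obtain as y bs cs where xs: "xs = as @ [y] @ bs @ [y] @ cs"
    using not_distinct_decomp[OF assms] by blast
  have "gen y * gens bs * gen y = (-1) ^ length bs * (gens bs * (gen y * gen y))"
    by (simp only: gen_gens_comm mult.assoc)
  then have "gens as * (gen y * gens bs * gen y) * gens cs = 0"
    by simp
  then show ?thesis
    by (simp add: xs mult.assoc)
qed

section \<open>Contraction\<close>

text \<open>The antiderivation dual to \<open>gen j\<close>, given by its Leibniz rule on words;
  \<open>contract_eq_iota\<close> identifies it with the contraction defined through the
  pairing.\<close>

fun word_iota :: "'a \<Rightarrow> 'a list \<Rightarrow> 'a ext" where
  "word_iota j [] = 0"
| "word_iota j (i # xs) = (if i = j then gens xs else 0) - gen i * word_iota j xs"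

text \<open>Induction on the prefix. Peeling off its first letter leaves, besides the hypothesis,
  only bare words, which vanish by the repeated letter or cancel by anticommutation.\<close>

lemma alternating_word_iota: "alternating (word_iota j)"
  unfolding alternating_def
proof (intro conjI allI)
  fix xs ys :: "'a list" and i k :: 'a
  show "word_iota j (xs @ i # i # ys) = 0"
  proof (induction xs)
    case Nil
    show ?case by (simp add: right_diff_distrib)
  next
    case (Cons x xs)
    then show ?case using gens_not_distinct[of "xs @ i # i # ys"] by simp
  qed
  have *: "gen a * (gen b * v) + gen b * (gen a * v) = 0" for a b and v :: "'a ext"
    using gen_anticomm_left[of a b v] by simp
  show "word_iota j (xs @ i # k # ys) + word_iota j (xs @ k # i # ys) = 0"
  proof (induction xs)
    case Nil
    show ?case by (simp add: right_diff_distrib *)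
  next
    case (Cons x xs)
    have "gens (xs @ i # k # ys) + gens (xs @ k # i # ys) = gens xs *
       (gen i * (gen k * gens ys) + gen k * (gen i * gens ys))"
      by (simp only: gens_simps distrib_left)
    also have "\<dots> = 0" by (simp only: * mult_zero_right)
    finally have g: "gens (xs @ i # k # ys) + gens (xs @ k # i # ys) = 0" .
    have "word_iota j ((x # xs) @ i # k # ys) + word_iota j ((x # xs) @ k # i # ys) =
      (if x = j then gens (xs @ i # k # ys) + gens (xs @ k # i # ys) else 0) -
      gen x * (word_iota j (xs @ i # k # ys) + word_iota j (xs @ k # i # ys))"
      by (simp only: append_Cons word_iota.simps distrib_left split: if_splits) simp
    then show ?case by (simp only: Cons g) simp
  qed
qed

definition iota :: "'a \<Rightarrow> 'a ext \<Rightarrow> 'a ext" where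
  "iota j = ext_lift (word_iota j)"

lemma additive_iota: "Modules.additive (iota j)"
  unfolding iota_def by (rule additive_ext_lift) (rule alternating_word_iota)

lemmas iota_add = Modules.additive.add[OF additive_iota]
  and iota_diff = Modules.additive.diff[OF additive_iota]
  and iota_minus = Modules.additive.minus[OF additive_iota]
  and iota_zero [simp] = Modules.additive.zero[OF additive_iota]

lemma iota_gens: "iota j (gens xs) = word_iota j xs"
  unfolding iota_def by (rule ext_lift_gens) (rule alternating_word_iota)

lemma iota_gen_mult: "iota j (gen i * u) = (if i = j then u else 0) - gen i * iota j u"
proof (induction u rule: ext_induct)
  case (gens xs)
  have "gen i * gens xs = gens (i # xs)" by simp
  then show ?case by (simp only: iota_gens word_iota.simps)
qed (auto simp: iota_diff right_diff_distrib)

lemma iota_one [simp]: "iota j 1 = 0"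
  using iota_gens[of j "[]"] by simp

lemma iota_mult_gen:
  assumes "i \<noteq> j"
  shows "iota j (u * gen i) = iota j u * gen i"
proof (induction u rule: ext_induct)
  case (gens xs)
  show ?case
    using assms iota_gen_mult[of j i 1]
    by (induction xs) (simp_all add: iota_gen_mult mult.assoc left_diff_distrib)
qed (simp add: iota_diff left_diff_distrib)

lemma iota_anticomm: "iota i (iota j u) + iota j (iota i u) = 0"
proof (induction u rule: ext_induct)
  case (gens xs)
  show ?case
  proof (induction xs)
    case (Cons x xs)
    have "iota i (iota j (gens (x # xs))) + iota j (iota i (gens (x # xs))) =
      gen x * (iota i (iota j (gens xs)) + iota j (iota i (gens xs)))"
      by (auto simp: iota_gen_mult iota_diff distrib_left)
    then show ?case by (simp only: Cons mult_zero_right)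
  qed simp
next
  case (diff u v)
  have "iota i (iota j (u - v)) + iota j (iota i (u - v)) =
    (iota i (iota j u) + iota j (iota i u)) - (iota i (iota j v) + iota j (iota i v))"
    by (simp add: iota_diff)
  then show ?case by (simp only: diff) simp
qed

lemma iota_square [simp]: "iota i (iota i u) = 0"
proof (induction u rule: ext_induct)
  case (gens xs)
  show ?case
    by (induction xs) (auto simp: iota_gen_mult iota_diff)
qed (simp add: iota_diff)

text \<open>The composite \<open>\<lambda>u. iota j (gen j * u)\<close> is the projection setting \<open>gen j\<close> to zero.\<close>

lemma iota_gen_gens: "iota j (gen j * gens xs) = (if j \<in> set xs then 0 else gens xs)"
proof (induction xs)
  case (Cons x xs)
  have *: "iota j (gen j * gens (x # xs)) = - iota j (gen x * (gen j * gens xs))" 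
    using gen_anticomm_left[of j x "gens xs"] by (simp add: iota_minus)
  show ?case
  proof (cases "x = j")
    case True
    then show ?thesis by simp
  next
    case False
    then have "iota j (gen j * gens (x # xs)) = gen x * iota j (gen j * gens xs)"
      by (simp only: * iota_gen_mult[of j x]) simp
    then show ?thesis using False by (simp only: Cons) simp
  qed
qed (use iota_gen_mult[of j j 1] in simp)

section \<open>Supports and the degree-zero part\<close>

lemma finite_support: "\<exists>J. finite J \<and> (\<forall>j. j \<notin> J \<longrightarrow> iota j (gen j * u) = u)"
proof (induction u rule: ext_induct)
  case (gens xs)
  show ?case by (rule exI[of _ "set xs"]) (simp add: iota_gen_gens)
next
  case (diff u v)
  then obtain I J where "finite I" "finite J" "\<And>j. j \<notin> I \<Longrightarrow> iota j (gen j * u) = u"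
    "\<And>j. j \<notin> J \<Longrightarrow> iota j (gen j * v) = v" by blast
  then show ?case
    by (intro exI[of _ "I \<union> J"]) (simp add: right_diff_distrib iota_diff)
qed

text \<open>An index outside the finite support of \<open>u\<close> gives a projection
  \<open>iota j (gen j * u)\<close> that returns \<open>u\<close>, while the hypothesis makes it
  zero.\<close>

lemma annihilator_gens:
  fixes u :: "'a ext"
  assumes "infinite (UNIV :: 'a set)" "\<And>j. gen j * u = 0"
  shows "u = 0"
proof -
  obtain J where "finite J" and J: "\<And>j. j \<notin> J \<Longrightarrow> iota j (gen j * u) = u"
    using finite_support[of u] by blast
  with assms(1) obtain j where "j \<notin> J" using ex_new_if_finite by blast
  then show ?thesis using J[of j] assms(2)[of j] by simp
qed

definition counit :: "'a ext \<Rightarrow> int" where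
  "counit = ext_lift (\<lambda>xs. if xs = [] then 1 else 0)"

lemma alternating_counit: "alternating (\<lambda>xs. if xs = [] then 1 else 0 :: int)"
  by (simp add: alternating_def)

lemma additive_counit: "Modules.additive counit"
  unfolding counit_def by (rule additive_ext_lift) (rule alternating_counit)

lemma counit_gens: "counit (gens xs) = (if xs = [] then 1 else 0)"
  unfolding counit_def by (rule ext_lift_gens[OF alternating_counit])

lemmas counit_diff = Modules.additive.diff[OF additive_counit]
  and counit_zero [simp] = Modules.additive.zero[OF additive_counit]

text \<open>If all contractions vanish, each projection that sets a letter to zero fixes
  \<open>u\<close>. Setting all letters of \<open>u\<close> to zero, on the other hand, leaves only
  its degree-zero part.\<close>

lemma eq_counit_if_iota_zero:
  assumes "\<And>j. iota j u = 0"
  shows "u = of_int (counit u)"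
proof -
  let ?K = "foldr (\<lambda>j u. iota j (gen j * u))"
  have K_diff: "?K L (v - w) = ?K L v - ?K L w" for L and v w :: "'a ext"
    by (induction L) (simp_all add: right_diff_distrib iota_diff)
  have zero: "?K L 0 = (0 :: 'a ext)" for L by (induction L) simp_all
  have K_gens: "?K L (gens xs) = (if set xs \<inter> set L = {} then gens xs else 0)" for L and xs :: "'a list"
    by (induction L) (auto simp: iota_gen_gens)
  \<comment> \<open>Asking for all larger lists lets the two lists of a difference be
    merged.\<close>
  have "\<exists>L. \<forall>L'. set L \<subseteq> set L' \<longrightarrow> ?K L' u = of_int (counit u)"
  proof (induction u rule: ext_induct)
    case (gens xs)
    show ?case by (rule exI[of _ xs]) (auto simp: K_gens counit_gens Int_absorb2)
  next
    case (diff u v)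
    then obtain L M where "\<And>L'. set L \<subseteq> set L' \<Longrightarrow> ?K L' u = of_int (counit u)"
      "\<And>L'. set M \<subseteq> set L' \<Longrightarrow> ?K L' v = of_int (counit v)" by blast
    then show ?case
      by (intro exI[of _ "L @ M"]) (simp add: K_diff counit_diff)
  qed
  then obtain L where "?K L u = of_int (counit u)" by blast
  moreover have "?K L u = u" for L
    using assms by (induction L) (simp_all add: iota_gen_mult)
  ultimately show ?thesis by simp
qed

subsection \<open>The pairing\<close>

text \<open>Pairs a product of dual vectors with \<open>u\<close> by contracting with its factors
  from the left and reading off the degree-zero part.\<close>

fun word_pairing :: "'a list \<Rightarrow> 'a ext \<Rightarrow> int" where
  "word_pairing [] u = counit u"
| "word_pairing (i # xs) u = word_pairing xs (iota i u)"

lemma additive_word_pairing: "Modules.additive (word_pairing xs)"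
proof (rule Modules.additive.intro)
  show "word_pairing xs (u + v) = word_pairing xs u + word_pairing xs v" for u v
    by (induction xs arbitrary: u v)
       (simp_all add: iota_add Modules.additive.add[OF additive_counit])
qed

lemmas word_pairing_add = Modules.additive.add[OF additive_word_pairing]
  and word_pairing_zero [simp] = Modules.additive.zero[OF additive_word_pairing]

lemma alternating_word_pairing: "alternating (\<lambda>xs. word_pairing xs u)"
  unfolding alternating_def
proof (intro conjI allI)
  fix xs ys :: "'a list" and i j :: 'a
  show "word_pairing (xs @ i # i # ys) u = 0"
    by (induction xs arbitrary: u) simp_all
  show "word_pairing (xs @ i # j # ys) u + word_pairing (xs @ j # i # ys) u = 0"
    by (induction xs arbitrary: u) (simp_all add: iota_anticomm flip: word_pairing_add)
qed

definition pairing :: "'a ext \<Rightarrow> 'a ext \<Rightarrow> int" where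
  "pairing \<eta> u = ext_lift (\<lambda>xs. word_pairing xs u) \<eta>"

lemma pairing_gens: "pairing (gens xs) u = word_pairing xs u"
  unfolding pairing_def by (rule ext_lift_gens) (rule alternating_word_pairing)

lemma additive_pairing_left: "Modules.additive (\<lambda>\<eta>. pairing \<eta> u)"
  unfolding pairing_def by (rule additive_ext_lift) (rule alternating_word_pairing)

lemmas pairing_diff_left = Modules.additive.diff[OF additive_pairing_left]

lemma additive_pairing_right: "Modules.additive (pairing \<eta>)"
proof (rule Modules.additive.intro)
  fix u v
  show "pairing \<eta> (u + v) = pairing \<eta> u + pairing \<eta> v"
    by (induction \<eta> rule: ext_induct)
       (simp_all add: pairing_gens word_pairing_add pairing_diff_left)
qed

lemma pairing_gen_mult: "pairing (gen j * \<eta>) u = pairing \<eta> (iota j u)"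
proof (induction \<eta> rule: ext_induct)
  case (gens xs)
  have "gen j * gens xs = gens (j # xs)" by simp
  then show ?case by (simp only: pairing_gens word_pairing.simps)
qed (simp add: right_diff_distrib pairing_diff_left)

text \<open>The closed form has the shape of a determinant expansion along a row, as
  \<open>word_pairing_gens\<close> requires.\<close>

lemma word_iota_eq_sum:
  "word_iota i js = (\<Sum>l<length js. if js ! l = i then (-1) ^ l * gens (take l js @ drop (Suc l) js) else 0)"
proof (induction js)
  case (Cons j js)
  have "gen j * word_iota i js =
    (\<Sum>l<length js. gen j * (if js ! l = i then (-1) ^ l * gens (take l js @ drop (Suc l) js) else 0))"
    by (simp only: Cons sum_distrib_left)
  also have "\<dots> = (\<Sum>l<length js. - (if js ! l = i then
      (-1) ^ Suc l * gens (take (Suc l) (j # js) @ drop (Suc (Suc l)) (j # js)) else 0))"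
  proof (rule sum.cong)
    fix l
    show "gen j * (if js ! l = i then (-1) ^ l * gens (take l js @ drop (Suc l) js) else 0) =
      - (if js ! l = i then
      (-1) ^ Suc l * gens (take (Suc l) (j # js) @ drop (Suc (Suc l)) (j # js)) else 0)"
      by (cases "even l") (simp_all add: mult.assoc)
  qed simp
  finally show ?case
    by (simp add: sum.lessThan_Suc_shift sum_negf del: sum.lessThan_Suc)
qed simp

text \<open>Contracting with the first letter is Laplace expansion along the first row: deleting
  position \<open>l\<close> deletes column \<open>l\<close>, and the induction hypothesis evaluates
  the minors.\<close>

lemma word_pairing_gens:
  "word_pairing is (gens js) = (if length is = length js
     then det (mat (length is) (length is) (\<lambda>(k, l). if is ! k = js ! l then 1 else 0)) else 0)"
proof (induction "is" arbitrary: js)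
  case Nil
  show ?case by (cases js) (simp_all add: counit_gens del: gens_simps)
next
  case (Cons i "is")
  let ?del = "\<lambda>l. take l js @ drop (Suc l) js"
  interpret W: Modules.additive "word_pairing is" by (rule additive_word_pairing)
  have "word_pairing (i # is) (gens js) =
      (\<Sum>l<length js. if js ! l = i then (-1) ^ l * word_pairing is (gens (?del l)) else 0)"
  proof -
    have "word_pairing is (if js ! l = i then (-1) ^ l * gens (?del l) else 0) =
        (if js ! l = i then (-1) ^ l * word_pairing is (gens (?del l)) else 0)" for l
      by (cases "even l") (simp_all add: W.minus)
    then show ?thesis by (simp add: iota_gens word_iota_eq_sum W.sum)
  qed
  also have "\<dots> = (if length (i # is) = length js
     then det (mat (length (i # is)) (length (i # is)) (\<lambda>(k, l). if (i # is) ! k = js ! l then 1 else 0)) else 0)"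
  proof (cases "length js = Suc (length is)")
    case False
    then have "word_pairing is (gens (?del l)) = 0" if "l < length js" for l
      using that by (subst Cons) auto
    then show ?thesis using False by (auto intro!: sum.neutral)
  next
    case True
    let ?n = "length is"
    let ?A = "mat (Suc ?n) (Suc ?n) (\<lambda>(k, l). if (i # is) ! k = js ! l then 1 else 0) :: int mat"
    have minor: "word_pairing is (gens (?del l)) = det (mat_delete ?A 0 l)" if "l < Suc ?n" for l
    proof -
      have "mat_delete ?A 0 l = mat ?n ?n (\<lambda>(k, l'). if is ! k = ?del l ! l' then 1 else 0)"
        using that True by (intro eq_matI) (auto simp: mat_delete_def nth_append)
      then show ?thesis using that True by (subst Cons) auto
    qed
    have "det ?A = (\<Sum>l<Suc ?n. ?A $$ (0, l) * cofactor ?A 0 l)"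
      by (rule laplace_expansion_row) simp_all
    also have "\<dots> = (\<Sum>l<length js. if js ! l = i then (-1) ^ l * word_pairing is (gens (?del l)) else 0)"
    proof (rule sum.cong)
      fix l
      assume "l \<in> {..<length js}"
      then show "?A $$ (0, l) * cofactor ?A 0 l =
          (if js ! l = i then (-1) ^ l * word_pairing is (gens (?del l)) else 0)"
        using True by (cases "js ! l = i") (simp_all add: cofactor_def minor del: gens_simps)
    qed (use True in simp)
    finally show ?thesis using True by simp
  qed
  finally show ?case .
qed

lemma ext_pairing_eq: "ext_pairing = (pairing :: int ext \<Rightarrow> _)"
  unfolding ext_pairing_def
proof (rule the_equality)
  let ?det = "\<lambda>is js. if length is = length js
     then det (mat (length is) (length is) (\<lambda>(k, l). if is ! k = js ! l then 1 else 0)) else 0"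
  show "(\<forall>\<eta>. Modules.additive (pairing \<eta>)) \<and> (\<forall>u. Modules.additive (\<lambda>\<eta>. pairing \<eta> u)) \<and>
     (\<forall>is js :: int list. pairing (gens is) (gens js) = ?det is js)"
    by (simp only: additive_pairing_left additive_pairing_right pairing_gens word_pairing_gens simp_thms)
  fix p :: "int ext \<Rightarrow> int ext \<Rightarrow> int"
  assume p: "(\<forall>\<eta>. Modules.additive (p \<eta>)) \<and> (\<forall>u. Modules.additive (\<lambda>\<eta>. p \<eta> u)) \<and>
     (\<forall>is js :: int list. p (gens is) (gens js) = ?det is js)"
  have p_gens: "p (gens is) u = pairing (gens is) u" for "is" u
  proof (rule additive_eqI_ext)
    show "Modules.additive (p (gens is))" using p by (elim conjE allE)
    show "p (gens is) (gens js) = pairing (gens is) (gens js)" for js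
      using p by (simp only: pairing_gens word_pairing_gens)
  qed (rule additive_pairing_right)
  have add: "Modules.additive (\<lambda>\<eta>. p \<eta> u)" for u
    using p by (elim conjE allE)
  have "p \<eta> u = pairing \<eta> u" for \<eta> u
    using additive_eqI_ext[OF add[of u] additive_pairing_left[of u]] p_gens by blast
  then show "p = pairing" by blast
qed

section \<open>Homogeneous components and nondegeneracy of the pairing\<close>

lemma gens_in_ext_power: "length xs = r \<Longrightarrow> gens xs \<in> ext_power r"
  unfolding ext_power_def by (rule group_closure.base) auto

lemma ext_power_induct [consumes 1, case_names zero gens diff]:
  assumes "u \<in> ext_power r" "P 0" "\<And>xs. length xs = r \<Longrightarrow> P (gens xs)"
    "\<And>u v. u \<in> ext_power r \<Longrightarrow> v \<in> ext_power r \<Longrightarrow> P u \<Longrightarrow> P v \<Longrightarrow> P (u - v)"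
  shows "P u"
  using assms(1) unfolding ext_power_def
  by (induction rule: group_closure.induct) (use assms(2-4) in \<open>auto simp: ext_power_def\<close>)

lemma ext_power_diff: "u \<in> ext_power r \<Longrightarrow> v \<in> ext_power r \<Longrightarrow> u - v \<in> ext_power r"
  unfolding ext_power_def by (rule group_closure.diff)

lemma gen_mult_ext_power: "u \<in> ext_power r \<Longrightarrow> gen j * u \<in> ext_power (Suc r)"
proof (induction rule: ext_power_induct)
  case zero
  show ?case by (simp add: ext_power_def)
next
  case (gens xs)
  then show ?case using gens_in_ext_power[of "j # xs"] by simp
qed (simp add: right_diff_distrib ext_power_diff)

lemma iota_ext_power: "u \<in> ext_power r \<Longrightarrow> iota j u \<in> ext_power (r - 1)"
proof (induction rule: ext_power_induct)
  case zero
  show ?case by (simp add: ext_power_def)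
next
  case (gens xs)
  then show ?case
  proof (induction xs arbitrary: r)
    case Nil
    then show ?case by (simp add: ext_power_def)
  next
    case (Cons x xs)
    have "gen x * iota j (gens xs) \<in> ext_power (length xs)"
    proof (cases xs)
      case Nil
      then show ?thesis by (simp add: ext_power_def)
    next
      case (Cons y ys)
      then show ?thesis
        using gen_mult_ext_power[OF Cons.IH[OF refl]] by simp
    qed
    moreover have "(if x = j then gens xs else 0) \<in> ext_power (length xs)"
      by (simp add: gens_in_ext_power) (simp add: ext_power_def)
    ultimately have "iota j (gens (x # xs)) \<in> ext_power (length xs)"
      by (simp only: gens_simps iota_gen_mult ext_power_diff)
    then show ?case using Cons.prems by auto
  qed
qed (simp add: iota_diff ext_power_diff)

text \<open>Pairing \<open>v\<close> with \<open>gen j * \<eta>\<close> is pairing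
  \<open>iota j v\<close> with \<open>\<eta>\<close>, so by induction all contractions vanish and
  \<open>v\<close> is an integer constant. In positive degree this constant is zero; in degree 0 it
  is the pairing with 1.\<close>

lemma pairing_nondegenerate:
  "v \<in> ext_power r \<Longrightarrow> (\<And>\<eta>. \<eta> \<in> ext_power r \<Longrightarrow> pairing \<eta> v = 0) \<Longrightarrow> v = 0"
proof (induction r arbitrary: v)
  case 0
  have "iota j v = 0" for j
    using \<open>v \<in> ext_power 0\<close> by (induction rule: ext_power_induct) (simp_all add: iota_diff)
  moreover have "counit v = 0"
    using 0(2)[of 1] gens_in_ext_power[of "[]"] pairing_gens[of "[]" v] by simp
  ultimately show ?case using eq_counit_if_iota_zero[of v] by simp
next
  case (Suc r)
  have "iota j v = 0" for j
  proof (rule Suc.IH)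
    show "iota j v \<in> ext_power r" using iota_ext_power[OF Suc.prems(1)] by simp
    show "pairing \<eta> (iota j v) = 0" if "\<eta> \<in> ext_power r" for \<eta>
      using Suc.prems(2)[OF gen_mult_ext_power[OF that, of j]] by (simp add: pairing_gen_mult)
  qed
  moreover have "counit v = 0"
    using Suc.prems(1) by (induction rule: ext_power_induct) (auto simp: counit_gens counit_diff)
  ultimately show ?case using eq_counit_if_iota_zero[of v] by simp
qed

text \<open>Contraction is adjoint to left multiplication by \<open>gen j\<close>, and nondegeneracy
  leaves only one candidate.\<close>

lemma contract_eq_iota:
  assumes "u \<in> ext_power r" "r \<ge> 1"
  shows "contract r (gen j) u = iota j u"
  unfolding contract_def ext_pairing_eq
proof (rule the_equality)
  show iota: "iota j u \<in> ext_power (r - 1) \<and>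
    (\<forall>\<eta>\<in>ext_power (r - 1). pairing \<eta> (iota j u) = pairing (gen j * \<eta>) u)"
    using iota_ext_power[OF assms(1)] by (simp add: pairing_gen_mult)
  fix v
  assume v: "v \<in> ext_power (r - 1) \<and> (\<forall>\<eta>\<in>ext_power (r - 1). pairing \<eta> v = pairing (gen j * \<eta>) u)"
  have "v - iota j u = 0"
    using v iota by (intro pairing_nondegenerate[of _ "r - 1"])
      (simp_all add: ext_power_diff Modules.additive.diff[OF additive_pairing_right])
  then show "v = iota j u" by simp
qed

section \<open>Hasse--Schmidt derivations\<close>

definition alg_lift :: "('a \<Rightarrow> 'b::ring_1) \<Rightarrow> 'a ext \<Rightarrow> 'b" where
  "alg_lift c = ext_lift (\<lambda>xs. prod_list (map c xs))"

lemma
  fixes c :: "'a \<Rightarrow> 'b::ring_1"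
  assumes square: "\<And>i. c i * c i = 0" and anti: "\<And>i j. c i * c j + c j * c i = 0"
  shows additive_alg_lift: "Modules.additive (alg_lift c)"
    and alg_lift_gens: "alg_lift c (gens xs) = prod_list (map c xs)"
    and alg_lift_mult: "alg_lift c (u * v) = alg_lift c u * alg_lift c v"
proof -
  have "alternating (\<lambda>xs. prod_list (map c xs))"
    unfolding alternating_def
  proof (intro conjI allI)
    fix xs ys :: "'a list" and i j
    have "prod_list (map c (xs @ i # i # ys)) = prod_list (map c xs) * (c i * c i) * prod_list (map c ys)"
      by (simp add: mult.assoc)
    then show "prod_list (map c (xs @ i # i # ys)) = 0" by (simp add: square)
    have "prod_list (map c (xs @ i # j # ys)) + prod_list (map c (xs @ j # i # ys)) =
       prod_list (map c xs) * (c i * c j + c j * c i) * prod_list (map c ys)"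
      by (simp add: algebra_simps)
    then show "prod_list (map c (xs @ i # j # ys)) + prod_list (map c (xs @ j # i # ys)) = 0"
      by (simp add: anti)
  qed
  note lift = ext_lift[OF this, folded alg_lift_def]
  show add: "Modules.additive (alg_lift c)" by (rule lift(1))
  show word: "alg_lift c (gens xs) = prod_list (map c xs)" for xs by (rule lift(2))
  have gens_mult: "alg_lift c (gens xs * v) = alg_lift c (gens xs) * alg_lift c v" for xs
  proof (induction v rule: ext_induct)
    case (gens ys)
    then show ?case using word[of "xs @ ys"] by (simp add: word)
  qed (simp add: right_diff_distrib Modules.additive.diff[OF add])
  show "alg_lift c (u * v) = alg_lift c u * alg_lift c v"
    by (induction u rule: ext_induct)
       (simp_all add: gens_mult left_diff_distrib Modules.additive.diff[OF add])
qed

text \<open>The two outer terms cancel, and the inner sum is the same expression for the sequence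
  shifted by one; hence the induction in steps of two.\<close>

lemma anticommuting_convolution_square:
  fixes x :: "nat \<Rightarrow> 'b::ring_1"
  assumes "\<And>a. x a * x a = 0" "\<And>a b. x a * x b + x b * x a = 0"
  shows "(\<Sum>a = 0..n. x a * x (n - a)) = 0"
  using assms
proof (induction n arbitrary: x rule: induct_nat_012)
  case (ge2 n)
  have "(\<Sum>a = 0..Suc (Suc n). x a * x (Suc (Suc n) - a)) =
      x 0 * x (Suc (Suc n)) + x (Suc (Suc n)) * x 0 + (\<Sum>a = 0..n. x (Suc a) * x (Suc n - a))"
    by (subst sum.atLeast0_atMost_Suc_shift) simp
  also have "(\<Sum>a = 0..n. x (Suc a) * x (Suc n - a)) = (\<Sum>a = 0..n. x (Suc a) * x (Suc (n - a)))"
    by (intro sum.cong) (simp_all add: Suc_diff_le)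
  also have "\<dots> = 0"
    by (rule ge2.IH(1)) (simp_all add: ge2.prems)
  finally show ?case by (simp add: ge2.prems)
qed simp_all

text \<open>The last two clauses make the series square to zero and anticommute, as an algebra map
  requires; the first pins down the image of 1.\<close>

definition hs_coeffs :: "(int \<Rightarrow> int ext fps) \<Rightarrow> bool" where
  "hs_coeffs c \<longleftrightarrow> (\<forall>i. fps_nth (c i) 0 = gen i) \<and> (\<forall>i a. fps_nth (c i) a * fps_nth (c i) a = 0) \<and>
     (\<forall>i j a b. fps_nth (c i) a * fps_nth (c j) b + fps_nth (c j) b * fps_nth (c i) a = 0)"

text \<open>\<open>hs_derivation\<close> does not mention the unit. The defect
  \<open>1 - D 1\<close> is annihilated by every \<open>c j\<close>; its lowest nonzero coefficient
  would then be annihilated by every \<open>gen j\<close>.\<close>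

lemma hs_derivation_one:
  assumes D: "hs_derivation D" "\<And>j. D (gen j) = c j" and c: "\<And>i. fps_nth (c i) 0 = gen i"
  shows "D 1 = 1"
proof -
  define q where "q = 1 - D 1"
  have "D (gen j) * D 1 = D (gen j)" for j
    using D(1) unfolding hs_derivation_def by (metis mult.right_neutral)
  then have q: "c j * q = 0" for j by (simp add: q_def right_diff_distrib D(2))
  have "fps_nth q n = 0" for n
  proof (induction n rule: less_induct)
    case (less n)
    show ?case
    proof (rule annihilator_gens)
      fix j :: int
      have "0 = fps_nth (c j * q) n" by (simp add: q)
      also have "\<dots> = (\<Sum>i = 0..n. fps_nth (c j) i * fps_nth q (n - i))"
        by (rule fps_mult_nth)
      also have "\<dots> = (\<Sum>i\<in>{0}. fps_nth (c j) i * fps_nth q (n - i))"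
        by (rule sum.mono_neutral_right) (auto simp: less)
      finally show "gen j * fps_nth q n = 0" by (simp add: c)
    qed (rule infinite_UNIV_int)
  qed
  then have "q = 0" by (intro fps_ext) simp
  then show ?thesis by (simp add: q_def)
qed

lemma hs_derivation_exists1:
  assumes "hs_coeffs c"
  shows "\<exists>!D. hs_derivation D \<and> (\<forall>j. D (gen j) = c j)"
proof (rule ex_ex1I)
  have c: "\<And>i. fps_nth (c i) 0 = gen i" "\<And>i a. fps_nth (c i) a * fps_nth (c i) a = 0"
    "\<And>i j a b. fps_nth (c i) a * fps_nth (c j) b + fps_nth (c j) b * fps_nth (c i) a = 0"
    using assms unfolding hs_coeffs_def by blast+
  have square: "c i * c i = 0" for i
    by (rule fps_ext) (simp add: fps_mult_nth anticommuting_convolution_square c)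
  have anti: "c i * c j + c j * c i = 0" for i j
  proof (rule fps_ext)
    fix n
    have "fps_nth (c j * c i) n = (\<Sum>a = 0..n. fps_nth (c j) (n - a) * fps_nth (c i) a)"
      unfolding fps_mult_nth by (rule sum.reindex_bij_witness[of _ "\<lambda>a. n - a" "\<lambda>a. n - a"]) auto
    then show "fps_nth (c i * c j + c j * c i) n = fps_nth 0 n"
      by (simp add: fps_mult_nth c flip: sum.distrib)
  qed
  note lift = additive_alg_lift[of c, OF square anti] alg_lift_gens[of c, OF square anti]
    alg_lift_mult[of c, OF square anti]
  have "alg_lift c (gen j) = c j" for j using lift(2)[of "[j]"] by simp
  then show "\<exists>D. hs_derivation D \<and> (\<forall>j. D (gen j) = c j)"
    unfolding hs_derivation_def using lift(1,3) by blast
  fix D D'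
  assume D: "hs_derivation D \<and> (\<forall>j. D (gen j) = c j)" and D': "hs_derivation D' \<and> (\<forall>j. D' (gen j) = c j)"
  show "D = D'"
  proof
    fix u
    have *: "E (gens xs) = prod_list (map c xs)" if E: "hs_derivation E \<and> (\<forall>j. E (gen j) = c j)" for E xs
    proof (induction xs)
      case Nil
      show ?case using hs_derivation_one[of E c] E c(1) by simp
    next
      case (Cons x xs)
      then show ?case using E by (simp add: hs_derivation_def)
    qed
    show "D u = D' u"
    proof (rule additive_eqI_ext)
      show "Modules.additive D" "Modules.additive D'" using D D' by (simp_all add: hs_derivation_def)
      show "D (gens xs) = D' (gens xs)" for xs using *[OF D] *[OF D'] by simp
    qed
  qed
qed

section \<open>Existence of the three Schubert derivations\<close>

lemma gen_sum_anticomm: "gen i * gen j + gen j * gen i = 0"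
  using gen_anticomm[of i j] by simp

lemma hs_coeffs_sigma:
  "hs_coeffs (\<lambda>j. Abs_fps (\<lambda>i. gen (j + int i)))"
  "hs_coeffs (\<lambda>j. Abs_fps (\<lambda>i. gen (j - int i)))"
  "hs_coeffs (\<lambda>j. fps_const (gen j) - fps_const (gen (j + 1)) * fps_X)"
proof -
  have nth: "fps_nth (fps_const (gen j) - fps_const (gen (j + 1)) * fps_X) n =
      (if n = 0 then gen j else if n = 1 then - gen (j + 1) else 0)" for j :: int and n
    by simp
  show "hs_coeffs (\<lambda>j. fps_const (gen j) - fps_const (gen (j + 1)) * fps_X)"
    unfolding hs_coeffs_def nth
    by (auto simp: gen_sum_anticomm add_eq_0_iff intro: gen_anticomm gen_anticomm[symmetric])
qed (simp_all add: hs_coeffs_def gen_sum_anticomm)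

lemma
  shows hs_sigma_plus: "hs_derivation sigma_plus"
    and sigma_plus_gen: "sigma_plus (gen j) = Abs_fps (\<lambda>i. gen (j + int i))"
    and hs_sigma_minus: "hs_derivation sigma_minus"
    and sigma_minus_gen: "sigma_minus (gen j) = Abs_fps (\<lambda>i. gen (j - int i))"
    and hs_sigma_plus_bar: "hs_derivation sigma_plus_bar"
    and sigma_plus_bar_gen: "sigma_plus_bar (gen j) = fps_const (gen j) - fps_const (gen (j + 1)) * fps_X"
  using theI'[OF hs_derivation_exists1[OF hs_coeffs_sigma(1)], folded sigma_plus_def]
    theI'[OF hs_derivation_exists1[OF hs_coeffs_sigma(2)], folded sigma_minus_def]
    theI'[OF hs_derivation_exists1[OF hs_coeffs_sigma(3)], folded sigma_plus_bar_def]
  by blast+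

lemma sigma_one [simp]: "sigma_plus 1 = 1" "sigma_minus 1 = 1" "sigma_plus_bar 1 = 1"
  using hs_derivation_one[OF hs_sigma_plus sigma_plus_gen]
    hs_derivation_one[OF hs_sigma_minus sigma_minus_gen]
    hs_derivation_one[OF hs_sigma_plus_bar sigma_plus_bar_gen]
  by simp_all

section \<open>The Fock space\<close>

lemma zero_in_fock_rel [simp]: "0 \<in> fock_rel" by (simp add: fock_rel_def)

lemma wedge_simps:
  "wedge (u + v) x = wedge u x + wedge v x"
  "wedge (u - v) x = wedge u x - wedge v x"
  "wedge u (x + y) = wedge u x + wedge u y"
  "wedge u (x - y) = wedge u x - wedge u y"
  "wedge 1 x = x"
  by (transfer; simp add: pre_scale_simps)+

lemma additive_wedge: "Modules.additive (wedge u)" "Modules.additive (\<lambda>u. wedge u x)"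
  by (simp_all add: Modules.additive_def wedge_simps)

lemmas wedge_zero [simp] = Modules.additive.zero[OF additive_wedge(1)] Modules.additive.zero[OF additive_wedge(2)]
  and wedge_minus = Modules.additive.minus[OF additive_wedge(1)] Modules.additive.minus[OF additive_wedge(2)]
  and wedge_sum = Modules.additive.sum[OF additive_wedge(1)] Modules.additive.sum[OF additive_wedge(2)]

lemma wedge_gen_anticomm: "wedge (gen i) (wedge (gen j) x) = - wedge (gen j) (wedge (gen i) x)"
  using gen_anticomm[of i j] by (simp flip: wedge_mult add: wedge_minus)

lemma wedge_gen_square [simp]: "wedge (gen i) (wedge (gen i) x) = 0"
  by (simp flip: wedge_mult)

lemma fock_of_single: "fock_of (Poly_Mapping.single m u) = wedge u (vac m)"
  by (simp add: vac.abs_eq wedge.abs_eq pre_scale_simps)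

lemma fock_induct [case_names gens diff]:
  assumes gens: "\<And>xs m. P (wedge (gens xs) (vac m))" and diff: "\<And>x y. P x \<Longrightarrow> P y \<Longrightarrow> P (x - y)"
  shows "P x"
proof -
  have P0: "P 0" using gens[of "[]" 0] diff by (metis diff_self)
  have add: "P (x + y)" if "P x" "P y" for x y
    using diff[OF that(1) diff[OF P0 that(2)]] by simp
  have single: "P (wedge u (vac m))" for u m
    by (induction u rule: ext_induct) (simp_all add: gens diff wedge_simps)
  obtain p where p: "x = fock_of p" by (metis Quotient_fock Quotient_abs_rep)
  show ?thesis unfolding p
  proof (induction p rule: update_induct)
    case const
    then show ?case using P0 by (simp add: zero_fock_def)
  next
    case (update f a b)
    have "Poly_Mapping.update a b f = Poly_Mapping.single a b + f"
      using update(1) by (intro poly_mapping_eqI)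
        (auto simp: lookup_update lookup_add lookup_single when_def in_keys_iff)
    then show ?case
      using add[OF single[of b a] update(3)] by (simp add: fock_of_single flip: plus_fock.abs_eq)
  qed
qed

text \<open>Universal property of the Fock space: \<open>shift\<close> and \<open>kill\<close> are
  the two families of defining relations, multiplied by \<open>u\<close>.\<close>

lemma fock_lift_exists:
  fixes g :: "int \<Rightarrow> int ext \<Rightarrow> 'b::ab_group_add"
  assumes add: "\<And>m. Modules.additive (g m)"
    and shift: "\<And>m u. g (m - 1) (u * gen m) = g m u"
    and kill: "\<And>m u. g m (u * gen m) = 0"
  shows "\<exists>T. Modules.additive T \<and> (\<forall>m u. T (wedge u (vac m)) = g m u)"
proof -
  define L :: "pre_fock \<Rightarrow> 'b" where
    "L x = (\<Sum>m\<in>Poly_Mapping.keys x. g m (Poly_Mapping.lookup x m))" for x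
  interpret L: Modules.additive L
    unfolding L_def using add
    by (intro Modules.additive.intro setsum_keys_plus_distrib)
       (simp_all add: Modules.additive.zero Modules.additive.add)
  have single: "L (Poly_Mapping.single m u) = g m u" for m u
    using Modules.additive.zero[OF add] by (simp add: L_def)
  have kills: "L w = 0" if "w \<in> fock_rel" for w
    using that unfolding fock_rel_def
  proof (induction rule: group_closure.induct)
    case (base s)
    then show ?case
      by (auto simp: fock_rel_gens_def pre_scale_simps L.zero L.diff single shift kill)
  qed (simp add: L.diff)
  define T where "T x = L (rep_fock x)" for x
  have T: "T (fock_of x) = L x" for x
  proof -
    have "rep_fock (fock_of x) - x \<in> fock_rel"
      by (rule Quotient_rep_abs[OF Quotient_fock]) simp
    then have "L (rep_fock (fock_of x) - x) = 0" by (rule kills)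
    then show ?thesis by (simp add: T_def L.diff)
  qed
  have "T (u + v) = T u + T v" for u v
  proof -
    obtain x y where "u = fock_of x" "v = fock_of y" by (metis Quotient_fock Quotient_abs_rep)
    then show ?thesis by (simp add: plus_fock.abs_eq T L.add)
  qed
  then have "Modules.additive T" by (rule Modules.additive.intro)
  moreover have "T (wedge u (vac m)) = g m u" for m u by (simp add: T single flip: fock_of_single)
  ultimately show ?thesis by blast
qed

text \<open>Write the vacuum as \<open>gen m\<close> wedged with the next lower one, move the
  generator past \<open>gen m\<close>, and repeat until its index is reached.\<close>

lemma wedge_gen_vac_le:
  assumes "i \<le> m"
  shows "wedge (gen i) (vac m) = 0"
proof -
  have "wedge (gen (m - int k)) (vac m) = 0" for k
  proof (induction k arbitrary: m)
    case 0
    show ?case by (simp add: wedge_gen_vac)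
  next
    case (Suc k)
    have "wedge (gen (m - int (Suc k))) (vac m) =
        - wedge (gen m) (wedge (gen (m - 1 - int k)) (vac (m - 1)))"
      using wedge_gen_vac(1)[of m] by (subst wedge_gen_anticomm[symmetric]) (simp add: algebra_simps)
    then show ?case by (simp only: Suc) simp
  qed
  from this[of "nat (m - i)"] show ?thesis using assms by simp
qed

lemma wedge_gen_gens: "wedge (gen i) (wedge (gens xs) x) = wedge ((-1) ^ length xs * gens xs) (wedge (gen i) x)"
  by (simp add: gen_gens_comm mult.assoc flip: wedge_mult)

lemma wedge_gens_low:
  assumes "i \<le> m"
  shows "wedge (gen i) (wedge (gens xs) (vac m)) = 0"
  by (simp add: wedge_gen_gens wedge_gen_vac_le assms)

lemma gen_eventually_kills: "\<exists>m. \<forall>i\<le>m. wedge (gen i) x = 0"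
proof (induction x rule: fock_induct)
  case (gens xs m)
  then show ?case using wedge_gens_low by blast
next
  case (diff x y)
  then obtain a b where "\<forall>i\<le>a. wedge (gen i) x = 0" "\<forall>i\<le>b. wedge (gen i) y = 0" by blast
  then show ?case by (intro exI[of _ "min a b"]) (simp add: wedge_simps)
qed

lemma vac_eq_wedge: "vac m = wedge (gens (map (\<lambda>i. m - int i) [0..<k])) (vac (m - int k))"
proof (induction k)
  case (Suc k)
  then show ?case
    using wedge_gen_vac(1)[of "m - int k"] by (simp add: wedge_mult algebra_simps)
qed (simp add: wedge_simps)

section \<open>Straightening of words: the partition vectors span\<close>

lemma gens_sort_sign: "\<exists>s\<in>{1, -1}. gens xs = s * gens (sort_key f xs)"
proof (induction xs)
  case (Cons x xs)
  have insort: "\<exists>s\<in>{1, -1}. gen x * gens ys = s * gens (insort_key f x ys)" for ys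
  proof (induction ys)
    case (Cons y ys)
    then obtain s where s: "s \<in> {1, -1}" "gen x * gens ys = s * gens (insort_key f x ys)" by blast
    have "gen x * gens (y # ys) = - (gen y * (gen x * gens ys))"
      using gen_anticomm_left[of x y "gens ys"] by simp
    also have "\<dots> = - s * gens (y # insort_key f x ys)" using s by auto
    finally show ?case using s(1) by (auto intro: bexI[of _ 1] bexI[of _ "-1"])
  qed simp
  from Cons obtain s where s: "s \<in> {1, -1}" "gens xs = s * gens (sort_key f xs)" by blast
  obtain t where "t \<in> {1, -1}" "gen x * gens (sort_key f xs) = t * gens (insort_key f x (sort_key f xs))"
    using insort by blast
  with s show ?case by (auto intro: bexI[of _ 1] bexI[of _ "-1"])
qed simp

lemma part_filter_nonzero:
  assumes "sorted_wrt (\<ge>) l"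
  shows "part (filter (\<lambda>x. x \<noteq> 0) l) i = (if i < length l then l ! i else 0)"
  using assms
proof (induction l arbitrary: i)
  case (Cons x l)
  show ?case
  proof (cases "x = 0")
    case True
    with Cons.prems have z: "\<forall>y\<in>set l. y = 0" by simp
    then have "filter (\<lambda>x. x \<noteq> 0) l = []" by (simp add: filter_empty_conv)
    then show ?thesis using True z by (cases i) (simp_all add: part_def)
  next
    case False
    show ?thesis
    proof (cases i)
      case 0
      then show ?thesis using False by (simp add: part_def)
    next
      case (Suc k)
      have "part (filter (\<lambda>x. x \<noteq> 0) (x # l)) i = part (filter (\<lambda>x. x \<noteq> 0) l) k"
        using False Suc by (simp add: part_def)
      also have "\<dots> = (if k < length l then l ! k else 0)"
        by (rule Cons.IH) (use Cons.prems in simp)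
      finally show ?thesis using Suc by simp
    qed
  qed
qed (simp add: part_def)

text \<open>The last entry exceeds \<open>k\<close> and each step to the left gains at least 1; this
  keeps the parts read off below nonnegative.\<close>

lemma strictly_decreasing_lower_bound:
  fixes zs :: "int list"
  assumes "sorted_wrt (>) zs" "\<forall>z\<in>set zs. k < z" "i < length zs"
  shows "k + int (length zs - i) \<le> zs ! i"
  using assms
proof (induction zs arbitrary: i)
  case (Cons z zs)
  show ?case
  proof (cases i)
    case 0
    show ?thesis
    proof (cases zs)
      case Nil
      then show ?thesis using 0 Cons.prems by simp
    next
      case (Cons y ys)
      then show ?thesis using 0 Cons.prems Cons.IH[of 0] by simp
    qed
  next
    case (Suc j)
    then show ?thesis using Cons by simp
  qed
qed simp

text \<open>The parts are the excesses of the letters over those of the vacuum of charge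
  \<open>m\<close>, with the trailing zeros removed.\<close>

lemma decreasing_word_eq_fock_basis:
  assumes dec: "sorted_wrt (>) zs" and low: "\<forall>z\<in>set zs. k < z"
  shows "\<exists>m lam. is_partition lam \<and> wedge (gens zs) (vac k) = fock_basis m lam"
proof -
  let ?r = "length zs"
  define m where "m = k + int ?r"
  define l where "l = map (\<lambda>i. nat (zs ! i - m + int i)) [0..<?r]"
  define lam where "lam = filter (\<lambda>x. x \<noteq> 0) l"
  have nonneg: "0 \<le> zs ! i - m + int i" if "i < ?r" for i
    using strictly_decreasing_lower_bound[OF dec low that] that by (simp add: m_def of_nat_diff)
  have "l ! Suc i \<le> l ! i" if "Suc i < length l" for i
  proof -
    have "zs ! Suc i < zs ! i" using that dec by (simp add: l_def sorted_wrt_iff_nth_less)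
    then show ?thesis using that by (simp add: l_def)
  qed
  then have sorted: "sorted_wrt (\<ge>) l"
    by (subst sorted_wrt_iff_nth_Suc_transp) (auto intro: transpI)
  then have "is_partition lam"
    by (simp add: is_partition_def lam_def sorted_wrt_filter)
  moreover have "b_wedge ?r m lam = gens zs"
  proof -
    have "part lam i = nat (zs ! i - m + int i)" if "i < ?r" for i
      unfolding lam_def part_filter_nonzero[OF sorted] using that by (simp add: l_def)
    then have "map (\<lambda>i. m - int i + int (part lam i)) [0..<?r] = zs"
      using nonneg by (intro nth_equalityI) simp_all
    then show ?thesis by (simp add: b_wedge_def)
  qed
  moreover have "length lam \<le> ?r"
    unfolding lam_def by (rule order_trans[OF length_filter_le]) (simp add: l_def)
  ultimately show ?thesis
    using fock_basis_eq[of lam ?r m] by (intro exI[of _ m] exI[of _ lam]) (simp add: m_def)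
qed

text \<open>Lower the vacuum below every letter, then sort the enlarged word. This spanning property
  makes operators specified on partition vectors unique.\<close>

lemma fock_basis_induct [case_names basis diff]:
  assumes basis: "\<And>m lam. is_partition lam \<Longrightarrow> P (fock_basis m lam)"
    and diff: "\<And>x y. P x \<Longrightarrow> P y \<Longrightarrow> P (x - y)"
  shows "P x"
proof (induction x rule: fock_induct)
  case (gens xs m)
  have P0: "P 0" using basis[of "[]" 0] diff by (metis diff_self is_partition_def empty_iff list.set(1) sorted_wrt.simps(1))
  obtain k where k: "k \<le> m" "\<forall>i\<in>set xs. k < i"
  proof
    define k where "k = Min (insert m (set xs))"
    have "k \<le> i" if "i \<in> insert m (set xs)" for i
      unfolding k_def using that by (intro Min_le) auto
    then show "k - 1 \<le> m" "\<forall>i\<in>set xs. k - 1 < i" by force+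
  qed
  define ys where "ys = xs @ map (\<lambda>i. m - int i) [0..<nat (m - k)]"
  have eq: "wedge (gens xs) (vac m) = wedge (gens ys) (vac k)"
    using vac_eq_wedge[of m "nat (m - k)"] k(1) by (simp add: ys_def wedge_mult)
  have low: "\<forall>i\<in>set ys. k < i" using k by (auto simp: ys_def)
  show ?case
  proof (cases "distinct ys")
    case False
    then show ?thesis using P0 by (simp add: eq gens_not_distinct)
  next
    case True
    let ?zs = "sort_key uminus ys"
    have "sorted (map uminus ?zs)" "distinct ?zs" using True by simp_all
    then have "sorted_wrt (>) ?zs"
      by (auto simp: sorted_wrt_iff_nth_less distinct_conv_nth order_less_le sorted_iff_nth_mono)
    then obtain m' lam where "is_partition lam" "wedge (gens ?zs) (vac k) = fock_basis m' lam"
      using decreasing_word_eq_fock_basis[of ?zs k] low by auto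
    then have P: "P (wedge (gens ?zs) (vac k))" using basis by simp
    from gens_sort_sign[of ys uminus] consider "gens ys = gens ?zs" | "gens ys = - gens ?zs" by auto
    then show ?thesis
      using P diff[OF P0 P] by cases (simp_all add: eq wedge_minus)
  qed
qed (rule diff)

section \<open>Extending derivations to the Fock space\<close>

lemma wedge_fps_nth: "fps_nth (wedge_fps p g) n = (\<Sum>i = 0..n. wedge (fps_nth p i) (fps_nth g (n - i)))"
  by (simp add: wedge_fps_def)

lemma wedge_fps_mult: "wedge_fps (p * q) g = wedge_fps p (wedge_fps q g)"
proof (rule fps_ext)
  fix n
  show "fps_nth (wedge_fps (p * q) g) n = fps_nth (wedge_fps p (wedge_fps q g)) n"
    using fps_mult_assoc_lemma[of "\<lambda>i j k. wedge (fps_nth p i) (wedge (fps_nth q j) (fps_nth g k))" n n]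
    by (simp add: wedge_fps_nth fps_mult_nth wedge_sum wedge_mult)
qed

lemma wedge_fps_simps:
  "wedge_fps (p + q) g = wedge_fps p g + wedge_fps q g"
  "wedge_fps (p - q) g = wedge_fps p g - wedge_fps q g"
  "wedge_fps p (g + h) = wedge_fps p g + wedge_fps p h"
  "wedge_fps p (g - h) = wedge_fps p g - wedge_fps p h"
  "wedge_fps 0 g = 0" "wedge_fps p 0 = 0"
  by (rule fps_ext; simp add: wedge_fps_nth wedge_simps sum.distrib sum_subtractf)+

lemma wedge_fps_const_nth: "fps_nth (wedge_fps (fps_const u) g) n = wedge u (fps_nth g n)"
proof -
  have "(\<Sum>i = 0..n. wedge (fps_nth (fps_const u) i) (fps_nth g (n - i))) =
      (\<Sum>i\<in>{0}. wedge (fps_nth (fps_const u) i) (fps_nth g (n - i)))"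
    by (rule sum.mono_neutral_right) auto
  then show ?thesis by (simp add: wedge_fps_nth)
qed

lemma wedge_fps_one: "wedge_fps 1 g = g"
  by (rule fps_ext) (simp add: wedge_fps_const_nth wedge_simps flip: fps_const_1_eq_1)

lemma wedge_fps_of_const_nth: "fps_nth (wedge_fps p (fps_const x)) n = wedge (fps_nth p n) x"
proof -
  have "(\<Sum>i = 0..n. wedge (fps_nth p i) (fps_nth (fps_const x) (n - i))) =
      (\<Sum>i\<in>{n}. wedge (fps_nth p i) (fps_nth (fps_const x) (n - i)))"
    by (rule sum.mono_neutral_right) auto
  then show ?thesis by (simp add: wedge_fps_nth)
qed

lemma wedge_fps_X_nth: "fps_nth (wedge_fps fps_X g) n = (if n = 0 then 0 else fps_nth g (n - 1))"
proof (cases n)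
  case (Suc k)
  have "(\<Sum>i = 0..n. wedge (fps_nth fps_X i) (fps_nth g (n - i))) =
      (\<Sum>i\<in>{1}. wedge (fps_nth fps_X i) (fps_nth g (n - i)))"
    by (rule sum.mono_neutral_right) (auto simp: Suc fps_X_def)
  then show ?thesis by (simp add: wedge_fps_nth Suc wedge_simps)
qed (simp add: wedge_fps_nth)

text \<open>The prescribed images of the vacua respect the two relations defining the Fock space, so
  that \<open>D\<close> extends.\<close>

definition hs_vacua :: "(int ext \<Rightarrow> int ext fps) \<Rightarrow> (int \<Rightarrow> fock fps) \<Rightarrow> bool" where
  "hs_vacua D V \<longleftrightarrow> hs_derivation D \<and> D 1 = 1 \<and>
     (\<forall>m. wedge_fps (D (gen m)) (V (m - 1)) = V m \<and> wedge_fps (D (gen m)) (V m) = 0)"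

text \<open>The universal property produces an extension, spanning identifies it with the uniquely
  described one, and the product rule then holds for every \<open>u\<close> and
  \<open>x\<close>.\<close>

lemma
  assumes "hs_vacua D V"
  shows additive_fock_extension: "Modules.additive (fock_extension D V)"
    and fock_extension_wedge:
      "fock_extension D V (wedge u x) = wedge_fps (D u) (fock_extension D V x)"
    and fock_extension_vac: "fock_extension D V (vac m) = V m"
proof -
  have D: "Modules.additive D" "\<And>u v. D (u * v) = D u * D v"
    and V: "\<And>m. wedge_fps (D (gen m)) (V (m - 1)) = V m" "\<And>m. wedge_fps (D (gen m)) (V m) = 0"
    using assms by (simp_all add: hs_vacua_def hs_derivation_def)
  let ?P = "\<lambda>T. Modules.additive T \<and>
     (\<forall>m lam r. is_partition lam \<longrightarrow> length lam \<le> r \<longrightarrow>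
        T (fock_basis m lam) = wedge_fps (D (b_wedge r m lam)) (V (m - int r)))"
  have "\<exists>T. Modules.additive T \<and> (\<forall>m u. T (wedge u (vac m)) = wedge_fps (D u) (V m))"
    by (rule fock_lift_exists)
       (simp_all add: Modules.additive_def Modules.additive.add[OF D(1)] D(2) wedge_fps_simps wedge_fps_mult V)
  then obtain T where T: "Modules.additive T" "\<And>m u. T (wedge u (vac m)) = wedge_fps (D u) (V m)"
    by blast
  have "fock_extension D V = T"
    unfolding fock_extension_def
  proof (rule the_equality)
    show PT: "?P T"
      using T by (auto simp: fock_basis_eq)
    fix S
    assume S: "?P S"
    show "S = T"
    proof
      fix x
      show "S x = T x"
      proof (induction x rule: fock_basis_induct)
        case (basis m lam)
        then show ?case using S PT by (metis order_refl)
      next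
        case (diff x y)
        then show ?case using S T(1) by (simp add: Modules.additive.diff)
      qed
    qed
  qed
  with T show "Modules.additive (fock_extension D V)" by simp
  have vac: "fock_extension D V (wedge u (vac m)) = wedge_fps (D u) (V m)" for u m
    using T \<open>fock_extension D V = T\<close> by simp
  show "fock_extension D V (wedge u x) = wedge_fps (D u) (fock_extension D V x)"
  proof (induction x rule: fock_induct)
    case (gens xs m)
    show ?case by (simp add: vac D wedge_fps_mult flip: wedge_mult)
  next
    case (diff x y)
    then show ?case
      using T(1) \<open>fock_extension D V = T\<close> by (simp add: Modules.additive.diff wedge_simps wedge_fps_simps)
  qed
  show "fock_extension D V (vac m) = V m"
    using vac[of 1 m] assms by (simp add: wedge_simps wedge_fps_one hs_vacua_def)
qed

section \<open>Extension of the three derivations to the Fock space\<close>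

lemma hs_vacua_sigma_minus: "hs_vacua sigma_minus (\<lambda>m. fps_const (vac m))"
proof -
  \<comment> \<open>Every term after the first carries a generator of index below \<open>m\<close>,
    which the vacuum of index \<open>m - 1\<close> kills.\<close>
  have "wedge_fps (sigma_minus (gen m)) (fps_const (vac (m - 1))) = fps_const (vac m)" for m
    by (rule fps_ext) (auto simp: wedge_fps_of_const_nth sigma_minus_gen wedge_gen_vac wedge_gen_vac_le)
  moreover have "wedge_fps (sigma_minus (gen m)) (fps_const (vac m)) = 0" for m
    by (rule fps_ext) (simp add: wedge_fps_of_const_nth sigma_minus_gen wedge_gen_vac_le)
  ultimately show ?thesis by (simp add: hs_vacua_def hs_sigma_minus)
qed

text \<open>Since \<open>sigma_plus (gen (m - 1))\<close> is \<open>gen (m - 1)\<close> plus z times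
  \<open>sigma_plus (gen m)\<close>, the second term dies against \<open>sigma_plus (gen m)\<close>
  and the first restores the vacuum.\<close>

lemma hs_vacua_sigma_plus:
  "hs_vacua sigma_plus (\<lambda>m. wedge_fps (sigma_plus (gen m)) (fps_const (vac (m - 1))))"
proof -
  have sq: "sigma_plus (gen m) * sigma_plus (gen m) = 0" for m
    using hs_sigma_plus Modules.additive.zero[of sigma_plus] gen_square[of m]
    unfolding hs_derivation_def by metis
  have "sigma_plus (gen (m - 1)) = fps_const (gen (m - 1)) + sigma_plus (gen m) * fps_X" for m
  proof (rule fps_ext)
    fix n show "fps_nth (sigma_plus (gen (m - 1))) n =
        fps_nth (fps_const (gen (m - 1)) + sigma_plus (gen m) * fps_X) n"
      by (cases n) (simp_all add: sigma_plus_gen algebra_simps)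
  qed
  then have "sigma_plus (gen m) * sigma_plus (gen (m - 1)) = sigma_plus (gen m) * fps_const (gen (m - 1))" for m
    by (simp add: distrib_left sq flip: mult.assoc)
  then have "wedge_fps (sigma_plus (gen m)) (wedge_fps (sigma_plus (gen (m - 1))) (fps_const (vac (m - 1 - 1))))
     = wedge_fps (sigma_plus (gen m)) (wedge_fps (fps_const (gen (m - 1))) (fps_const (vac (m - 1 - 1))))" for m
    by (simp flip: wedge_fps_mult)
  moreover have "wedge_fps (fps_const (gen (m - 1))) (fps_const (vac (m - 1 - 1))) = fps_const (vac (m - 1))" for m
    using wedge_gen_vac(1)[of "m - 1"] by (intro fps_ext) (simp add: wedge_fps_const_nth)
  moreover have "wedge_fps (sigma_plus (gen m)) (wedge_fps (sigma_plus (gen m)) (fps_const (vac (m - 1)))) = 0" for m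
    by (simp add: sq wedge_fps_simps flip: wedge_fps_mult)
  ultimately show ?thesis unfolding hs_vacua_def by (simp add: hs_sigma_plus)
qed

definition bar_vac :: "nat \<Rightarrow> int \<Rightarrow> fock" where
  "bar_vac j m = wedge ((-1) ^ j) (fock_basis m (replicate j 1))"

lemma bar_vac_simps:
  "bar_vac 0 m = vac m"
  "bar_vac (Suc j) m = - wedge (gen (m + 1)) (bar_vac j (m - 1))"
proof -
  show "bar_vac 0 m = vac m" by (simp add: bar_vac_def fock_basis_def b_wedge_def wedge_simps)
  \<comment> \<open>Split off the top box of a column: the first factor is b_{m+1}, and a column of
    height \<open>j\<close> at charge \<open>m - 1\<close> remains.\<close>
  have "b_wedge (Suc j) m (replicate (Suc j) 1) = gen (m + 1) * b_wedge j (m - 1) (replicate j 1)"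
    by (simp add: b_wedge_def map_upt_Suc part_def algebra_simps del: upt_Suc replicate_Suc cong: if_cong)
  then have "fock_basis m (replicate (Suc j) 1) = wedge (gen (m + 1)) (fock_basis (m - 1) (replicate j 1))"
    by (simp add: fock_basis_def wedge_mult algebra_simps del: replicate_Suc)
  then show "bar_vac (Suc j) m = - wedge (gen (m + 1)) (bar_vac j (m - 1))"
    by (cases "even j") (simp_all add: bar_vac_def wedge_minus wedge_simps del: replicate_Suc)
qed

text \<open>A column of positive height at charge \<open>m\<close> starts with
  \<open>gen (m + 1)\<close>, so that generator kills it. \<open>gen m\<close>, moved past it, meets
  a shorter column that it kills unless that column is empty.\<close>

lemma wedge_gen_bar_vac:
  "wedge (gen m) (bar_vac j (m - 1)) = (if j = 0 then vac m else 0)"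
  "wedge (gen m) (bar_vac j m) = (if j = 1 then vac (m + 1) else 0)"
proof -
  show *: "wedge (gen m) (bar_vac j (m - 1)) = (if j = 0 then vac m else 0)" for j m
    by (cases j) (simp_all add: bar_vac_simps wedge_gen_vac wedge_minus)
  show "wedge (gen m) (bar_vac j m) = (if j = 1 then vac (m + 1) else 0)"
  proof (cases j)
    case (Suc k)
    then show ?thesis
      using wedge_gen_anticomm[of m "m + 1" "bar_vac k (m - 1)"] wedge_gen_vac(1)[of "m + 1"]
      by (simp add: bar_vac_simps * wedge_minus)
  qed (simp add: bar_vac_simps wedge_gen_vac)
qed

lemma wedge_fps_sigma_plus_bar_gen_nth:
  "fps_nth (wedge_fps (sigma_plus_bar (gen j)) g) n =
     wedge (gen j) (fps_nth g n) - (if n = 0 then 0 else wedge (gen (j + 1)) (fps_nth g (n - 1)))"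
  by (simp add: sigma_plus_bar_gen wedge_fps_simps wedge_fps_mult wedge_fps_const_nth wedge_fps_X_nth)

lemma hs_vacua_sigma_plus_bar: "hs_vacua sigma_plus_bar (\<lambda>m. Abs_fps (\<lambda>j. bar_vac j m))"
proof -
  have "wedge_fps (sigma_plus_bar (gen m)) (Abs_fps (\<lambda>j. bar_vac j (m - 1))) = Abs_fps (\<lambda>j. bar_vac j m)" for m
  proof (rule fps_ext)
    fix n show "fps_nth (wedge_fps (sigma_plus_bar (gen m)) (Abs_fps (\<lambda>j. bar_vac j (m - 1)))) n =
        fps_nth (Abs_fps (\<lambda>j. bar_vac j m)) n"
      by (cases n) (simp_all add: wedge_fps_sigma_plus_bar_gen_nth wedge_gen_bar_vac bar_vac_simps wedge_gen_vac wedge_minus)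
  qed
  moreover have "wedge_fps (sigma_plus_bar (gen m)) (Abs_fps (\<lambda>j. bar_vac j m)) = 0" for m
  proof (rule fps_ext)
    fix n
    have "wedge (gen (m + 1)) (bar_vac k m) = (if k = 0 then vac (m + 1) else 0)" for k
      using wedge_gen_bar_vac(1)[of "m + 1" k] by simp
    then show "fps_nth (wedge_fps (sigma_plus_bar (gen m)) (Abs_fps (\<lambda>j. bar_vac j m))) n = fps_nth 0 n"
      by (cases n) (simp_all add: wedge_fps_sigma_plus_bar_gen_nth wedge_gen_bar_vac)
  qed
  ultimately show ?thesis by (simp add: hs_vacua_def hs_sigma_plus_bar)
qed

section \<open>Coefficients of the extended derivations as operators\<close>

definition fps_at :: "int \<Rightarrow> 'b::zero fps \<Rightarrow> 'b" where
  "fps_at k f = (if k < 0 then 0 else fps_nth f (nat k))"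

definition minus_op :: "int \<Rightarrow> fock \<Rightarrow> fock" where
  "minus_op k x = fps_at k (fock_sigma_minus x)"

definition bar_op :: "int \<Rightarrow> fock \<Rightarrow> fock" where
  "bar_op k x = fps_at k (fock_sigma_plus_bar x)"

definition plus_op :: "int \<Rightarrow> fock \<Rightarrow> fock" where
  "plus_op k x = fps_at k (fock_sigma_plus x)"

lemma fock_sigma_plus_bar_alt:
  "fock_sigma_plus_bar = fock_extension sigma_plus_bar (\<lambda>m. Abs_fps (\<lambda>j. bar_vac j m))"
  by (simp add: fock_sigma_plus_bar_def bar_vac_def)

lemma fps_at_additive: "fps_at k (f + g) = fps_at k f + (fps_at k g :: 'b::monoid_add)"
  by (simp add: fps_at_def)

lemma additive_ops:
  "Modules.additive (minus_op k)" "Modules.additive (bar_op k)" "Modules.additive (plus_op k)"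
  using Modules.additive.add[OF additive_fock_extension[OF hs_vacua_sigma_minus]]
    Modules.additive.add[OF additive_fock_extension[OF hs_vacua_sigma_plus_bar]]
    Modules.additive.add[OF additive_fock_extension[OF hs_vacua_sigma_plus]]
  unfolding Modules.additive_def minus_op_def bar_op_def plus_op_def fock_sigma_minus_def
    fock_sigma_plus_bar_alt fock_sigma_plus_def
  by (simp_all add: fps_at_additive)

lemmas minus_op_diff = Modules.additive.diff[OF additive_ops(1)]
  and bar_op_diff = Modules.additive.diff[OF additive_ops(2)]
  and plus_op_diff = Modules.additive.diff[OF additive_ops(3)]
  and bar_op_add = Modules.additive.add[OF additive_ops(2)]
  and bar_op_minus = Modules.additive.minus[OF additive_ops(2)]
  and op_zero [simp] = Modules.additive.zero[OF additive_ops(1)] Modules.additive.zero[OF additive_ops(2)]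
    Modules.additive.zero[OF additive_ops(3)]

text \<open>Vanishing at negative indices lets the recursions below hold for every integer
  index.\<close>

lemma op_neg [simp]:
  "k < 0 \<Longrightarrow> minus_op k x = 0" "k < 0 \<Longrightarrow> bar_op k x = 0" "k < 0 \<Longrightarrow> plus_op k x = 0"
  by (simp_all add: minus_op_def bar_op_def plus_op_def fps_at_def)

text \<open>Coefficient form of sigma_-(z) b_i = b_i + z^{-1} sigma_-(z) b_{i-1}.\<close>

lemma minus_op_wedge:
  "minus_op k (wedge (gen i) x) = minus_op (k - 1) (wedge (gen (i - 1)) x) + wedge (gen i) (minus_op k x)"
proof (cases "k < 0")
  case False
  then obtain n where k: "k = int n" by (metis nonneg_int_cases not_less)
  have nth: "fps_nth (fock_sigma_minus (wedge (gen i) x)) n =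
     (\<Sum>a = 0..n. wedge (gen (i - int a)) (fps_nth (fock_sigma_minus x) (n - a)))" for i n
    unfolding fock_sigma_minus_def fock_extension_wedge[OF hs_vacua_sigma_minus]
    by (simp add: wedge_fps_nth sigma_minus_gen)
  show ?thesis
  proof (cases n)
    case (Suc n')
    then have k': "k = int (Suc n')" "k - 1 = int n'" by (simp_all add: k)
    have "minus_op k y = fps_nth (fock_sigma_minus y) (Suc n')" for y
      by (simp only: k'(1) minus_op_def fps_at_def nat_int of_nat_less_0_iff if_False)
    moreover have "minus_op (k - 1) y = fps_nth (fock_sigma_minus y) n'" for y
      by (simp only: k'(2) minus_op_def fps_at_def nat_int of_nat_less_0_iff if_False)
    ultimately show ?thesis
      by (simp only: nth sum.atLeast0_atMost_Suc_shift) (simp add: algebra_simps)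
  qed (simp add: k minus_op_def fps_at_def nth)
qed simp

lemma minus_op_vac: "minus_op k (vac m) = (if k = 0 then vac m else 0)"
  by (auto simp: minus_op_def fps_at_def fock_sigma_minus_def fock_extension_vac[OF hs_vacua_sigma_minus])

lemma bar_op_wedge:
  "bar_op k (wedge (gen i) x) = wedge (gen i) (bar_op k x) - wedge (gen (i + 1)) (bar_op (k - 1) x)"
proof (cases "k < 0")
  case False
  then show ?thesis
    by (auto simp: bar_op_def fps_at_def fock_sigma_plus_bar_alt nat_diff_distrib
        fock_extension_wedge[OF hs_vacua_sigma_plus_bar] wedge_fps_sigma_plus_bar_gen_nth)
qed simp

lemma bar_op_vac: "bar_op k (vac m) = (if k < 0 then 0 else bar_vac (nat k) m)"
  by (simp add: bar_op_def fps_at_def fock_sigma_plus_bar_alt fock_extension_vac[OF hs_vacua_sigma_plus_bar])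

text \<open>Coefficient form of sigma_+(z) b_i = b_i + z sigma_+(z) b_{i+1}.\<close>

lemma plus_op_wedge:
  "plus_op k (wedge (gen i) x) = wedge (gen i) (plus_op k x) + plus_op (k - 1) (wedge (gen (i + 1)) x)"
proof (cases "k < 0")
  case False
  then obtain n where k: "k = int n" by (metis nonneg_int_cases not_less)
  have nth: "fps_nth (fock_sigma_plus (wedge (gen i) x)) n =
     (\<Sum>a = 0..n. wedge (gen (i + int a)) (fps_nth (fock_sigma_plus x) (n - a)))" for i n
    unfolding fock_sigma_plus_def fock_extension_wedge[OF hs_vacua_sigma_plus]
    by (simp add: wedge_fps_nth sigma_plus_gen)
  show ?thesis
  proof (cases n)
    case (Suc n')
    then have k': "k = int (Suc n')" "k - 1 = int n'" by (simp_all add: k)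
    have "plus_op k y = fps_nth (fock_sigma_plus y) (Suc n')" for y
      by (simp only: k'(1) plus_op_def fps_at_def nat_int of_nat_less_0_iff if_False)
    moreover have "plus_op (k - 1) y = fps_nth (fock_sigma_plus y) n'" for y
      by (simp only: k'(2) plus_op_def fps_at_def nat_int of_nat_less_0_iff if_False)
    ultimately show ?thesis
      by (simp only: nth sum.atLeast0_atMost_Suc_shift) (simp add: algebra_simps)
  qed (simp add: k plus_op_def fps_at_def nth)
qed simp

lemma plus_op_vac: "plus_op k (vac m) = (if k < 0 then 0 else wedge (gen (m + k)) (vac (m - 1)))"
  unfolding plus_op_def fps_at_def fock_sigma_plus_def fock_extension_vac[OF hs_vacua_sigma_plus]
  by (simp add: wedge_fps_of_const_nth sigma_plus_gen)

lemma op_0 [simp]: "bar_op 0 x = x" "plus_op 0 x = x"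
proof -
  show "bar_op 0 x = x"
  proof (induction x rule: fock_induct)
    case (gens xs m)
    show ?case
      by (induction xs) (simp_all add: wedge_simps wedge_mult bar_op_wedge bar_op_vac bar_vac_simps)
  qed (simp add: bar_op_diff)
  have "plus_op 0 (wedge (gen i) x) = wedge (gen i) (plus_op 0 x)" for i x
    by (subst plus_op_wedge) simp
  note plus_op_0_wedge = this
  show "plus_op 0 x = x"
  proof (induction x rule: fock_induct)
    case (gens xs m)
    show ?case
      by (induction xs) (simp_all add: wedge_simps wedge_mult plus_op_0_wedge plus_op_vac wedge_gen_vac)
  qed (simp add: plus_op_diff)
qed

section \<open>Commutation and inversion of the coefficient operators\<close>

lemma zero_if_commutes_with_gens:
  assumes "\<And>x y. U (x - y) = U x - U y" "\<And>i x. U (wedge (gen i) x) = wedge (gen i) (U x)"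
    "\<And>m. U (vac m) = 0"
  shows "U x = (0 :: fock)"
proof (induction x rule: fock_induct)
  case (gens xs m)
  show ?case by (induction xs) (simp_all add: assms wedge_simps wedge_mult)
qed (simp add: assms)

text \<open>Unless both indices are 0, each term of the double image is zero or has
  \<open>gen (n + 1)\<close> or \<open>gen (n + 2)\<close> as a factor.\<close>

lemma bar_op_bar_op_vac_killed:
  assumes "k \<noteq> 0 \<or> l \<noteq> 0"
  shows "wedge (gen (n + 2)) (wedge (gen (n + 1)) (bar_op k (bar_op l (vac n)))) = 0"
proof -
  have pos: "\<exists>y. bar_op k (vac n) = - wedge (gen (n + 1)) y" if "k > 0" for k
    using that bar_vac_simps(2)[of "nat k - 1" n] by (auto simp: bar_op_vac)
  consider "k < 0 \<or> l < 0" | "l > 0" | "l = 0" "k > 0" using assms by linarith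
  then show ?thesis
  proof cases
    case 2
    then obtain y where "bar_op l (vac n) = - wedge (gen (n + 1)) y" using pos by blast
    then have "bar_op k (bar_op l (vac n)) =
        wedge (gen (n + 2)) (bar_op (k - 1) y) - wedge (gen (n + 1)) (bar_op k y)"
      by (simp add: bar_op_minus bar_op_wedge add.assoc)
    then show ?thesis
      using wedge_gen_anticomm[of "n + 2" "n + 1"] by (simp add: wedge_simps wedge_minus)
  next
    case 3
    then obtain y where "bar_op k (vac n) = - wedge (gen (n + 1)) y" using pos by blast
    then show ?thesis using 3 by (simp add: wedge_minus)
  qed auto
qed

text \<open>Induction on \<open>k + l\<close>: by \<open>rec\<close> the commutator commutes with
  every generator up to commutators of smaller total index. On a vacuum, two generators are split
  off and carried through the commutator, and they kill what it leaves.\<close>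

lemma bar_op_commute: "bar_op k (bar_op l x) = bar_op l (bar_op k x)"
proof -
  let ?C = "\<lambda>k l x. bar_op k (bar_op l x) - bar_op l (bar_op k x)"
  have rec: "?C k l (wedge (gen i) x) = wedge (gen i) (?C k l x) - wedge (gen (i + 1)) (?C k (l - 1) x)
      - wedge (gen (i + 1)) (?C (k - 1) l x) + wedge (gen (i + 2)) (?C (k - 1) (l - 1) x)" for k l i x
  proof -
    have "bar_op k (bar_op l (wedge (gen i) x)) =
        wedge (gen i) (bar_op k (bar_op l x)) - wedge (gen (i + 1)) (bar_op (k - 1) (bar_op l x))
        - (wedge (gen (i + 1)) (bar_op k (bar_op (l - 1) x)) - wedge (gen (i + 2)) (bar_op (k - 1) (bar_op (l - 1) x)))"
      for k l by (simp only: bar_op_wedge bar_op_diff add.assoc one_add_one)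
    then show ?thesis by (simp only: wedge_simps) simp
  qed
  have "?C k l x = 0" if "nat (k + l) = n" for n k l x
    using that
  proof (induction n arbitrary: k l x rule: less_induct)
    case (less n)
    show ?case
    proof (cases "k \<ge> 0 \<and> l \<ge> 0")
      case True
      have IH: "?C k' l' x = 0" if "k' + l' < k + l" for k' l' x
      proof (cases "k' < 0 \<or> l' < 0")
        case False
        then show ?thesis using that less.prems by (intro less.IH[OF _ refl]) auto
      qed auto
      have comm: "?C k l (wedge (gen i) x) = wedge (gen i) (?C k l x)" for i x
        unfolding rec by (simp only: IH) simp
      show ?thesis
      proof (rule zero_if_commutes_with_gens[OF _ comm])
        show "?C k l (x - y) = ?C k l x - ?C k l y" for x y by (simp add: bar_op_diff)
        show "?C k l (vac m) = 0" for m
        proof (cases "k = 0 \<and> l = 0")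
          case False
          have "vac m = wedge (gen (m - 2 + 2)) (wedge (gen (m - 2 + 1)) (vac (m - 2)))"
            using wedge_gen_vac(1)[of m] wedge_gen_vac(1)[of "m - 1"] by simp
          then have "?C k l (vac m) =
             wedge (gen (m - 2 + 2)) (wedge (gen (m - 2 + 1)) (?C k l (vac (m - 2))))"
            by (simp only: comm)
          then show ?thesis
            using False bar_op_bar_op_vac_killed[of k l "m - 2"] bar_op_bar_op_vac_killed[of l k "m - 2"]
            by (auto simp: wedge_simps)
        qed simp
      qed
    qed auto
  qed
  then show ?thesis by simp
qed

text \<open>In positive degree the composite commutes with the generators, by the result for the
  preceding degree, so only the vacuum remains; there the sum telescopes.\<close>

lemma bar_plus_inverse:
  "(\<Sum>k = 0..n. bar_op (int k) (plus_op (int n - int k) x)) = (if n = 0 then x else 0)"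
proof -
  let ?P = "\<lambda>n x. \<Sum>k = 0..n. bar_op (int k) (plus_op (int n - int k) x)"
  have rec: "?P (Suc n) (wedge (gen i) x) =
      wedge (gen i) (?P (Suc n) x) - wedge (gen (i + 1)) (?P n x) + ?P n (wedge (gen (i + 1)) x)" for n i x
  proof -
    have step: "bar_op k (plus_op l (wedge (gen i) x)) = wedge (gen i) (bar_op k (plus_op l x))
       - wedge (gen (i + 1)) (bar_op (k - 1) (plus_op l x))
       + bar_op k (plus_op (l - 1) (wedge (gen (i + 1)) x))" for k l
      by (subst plus_op_wedge) (simp only: bar_op_add bar_op_wedge)
    have "?P (Suc n) (wedge (gen i) x) =
       wedge (gen i) (?P (Suc n) x)
       - (\<Sum>k = 0..Suc n. wedge (gen (i + 1)) (bar_op (int k - 1) (plus_op (int (Suc n) - int k) x)))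
       + (\<Sum>k = 0..Suc n. bar_op (int k) (plus_op (int (Suc n) - int k - 1) (wedge (gen (i + 1)) x)))"
      by (simp only: step sum.distrib sum_subtractf wedge_sum)
    also have "(\<Sum>k = 0..Suc n. wedge (gen (i + 1)) (bar_op (int k - 1) (plus_op (int (Suc n) - int k) x)))
        = wedge (gen (i + 1)) (?P n x)"
      by (subst sum.atLeast0_atMost_Suc_shift) (simp add: wedge_sum)
    also have "(\<Sum>k = 0..Suc n. bar_op (int k) (plus_op (int (Suc n) - int k - 1) (wedge (gen (i + 1)) x)))
        = ?P n (wedge (gen (i + 1)) x)"
      by (subst sum.atLeast0_atMost_Suc) simp
    finally show ?thesis .
  qed
  have vac: "?P (Suc n) (vac m) = 0" for n m
  proof -
    \<comment> \<open>Each summand on the vacuum splits by \<open>bar_op_wedge\<close> into two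
      consecutive values of \<open>f\<close>.\<close>
    define f where "f k = wedge (gen (m + int (Suc n) - k)) (bar_op k (vac (m - 1)))" for k
    have tele: "(\<Sum>k = 0..N. f (int k) - f (int k - 1)) = f (int N) - f (- 1)" for N
      by (induction N) simp_all
    have step: "bar_op (int k) (plus_op (int (Suc n) - int k) (vac m)) = f (int k) - f (int k - 1)"
      if "k \<le> Suc n" for k
    proof -
      have "plus_op (int (Suc n) - int k) (vac m) = wedge (gen (m + int (Suc n) - int k)) (vac (m - 1))"
        using that by (simp add: plus_op_vac add_diff_eq)
      then show ?thesis by (simp add: bar_op_wedge f_def algebra_simps)
    qed
    have "?P (Suc n) (vac m) = (\<Sum>k = 0..Suc n. f (int k) - f (int k - 1))"
      by (rule sum.cong[OF refl], rule step) simp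
    also have "\<dots> = f (int (Suc n)) - f (- 1)" by (rule tele)
    \<comment> \<open>\<open>f (- 1)\<close> involves a negative index; at the other end
      \<open>gen m\<close> meets a column of positive height at charge \<open>m - 1\<close>.\<close>
    also have "\<dots> = 0"
      by (simp add: f_def bar_op_vac wedge_gen_bar_vac del: of_nat_Suc)
    finally show ?thesis .
  qed
  have "?P (Suc n) x = 0" for n x
  proof (induction n arbitrary: x)
    case 0
    show ?case
    proof (rule zero_if_commutes_with_gens[where U = "?P (Suc 0)"])
      show "?P (Suc 0) (vac m) = 0" for m by (rule vac)
      \<comment> \<open>The degree-zero composite is the identity, so the last two terms of
        \<open>rec\<close> cancel.\<close>
      show "?P (Suc 0) (wedge (gen i) x) = wedge (gen i) (?P (Suc 0) x)" for i x
        by (simp only: rec) simp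
      show "?P (Suc 0) (x - y) = ?P (Suc 0) x - ?P (Suc 0) y" for x y
        by (simp only: bar_op_diff plus_op_diff sum_subtractf)
    qed
  next
    case (Suc n)
    show ?case
    proof (rule zero_if_commutes_with_gens[where U = "?P (Suc (Suc n))"])
      show "?P (Suc (Suc n)) (vac m) = 0" for m by (rule vac)
      show "?P (Suc (Suc n)) (wedge (gen i) x) = wedge (gen i) (?P (Suc (Suc n)) x)" for i x
        by (subst rec) (simp only: Suc wedge_zero diff_0_right add_0_right)
      show "?P (Suc (Suc n)) (x - y) = ?P (Suc (Suc n)) x - ?P (Suc (Suc n)) y" for x y
        by (simp only: bar_op_diff plus_op_diff sum_subtractf)
    qed
  qed
  then show ?thesis by (cases n) simp_all
qed

section \<open>The action of the ring of symmetric functions\<close>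

text \<open>The action of the variable of index \<open>i\<close>, which is e_{i+1}; the sign undoes
  the one that E(z) puts in front of it.\<close>

definition e_op :: "nat \<Rightarrow> fock \<Rightarrow> fock" where
  "e_op i x = (if even i then - bar_op (int (Suc i)) x else bar_op (int (Suc i)) x)"

lemma e_op_diff: "e_op i (x - y) = e_op i x - e_op i y"
  by (simp add: e_op_def bar_op_diff)

lemma e_op_commute: "e_op i (e_op j x) = e_op j (e_op i x)"
  using bar_op_commute[of "int (Suc i)" "int (Suc j)" x]
  by (simp add: e_op_def bar_op_minus del: of_nat_Suc)

primrec monomial_op_upto :: "nat \<Rightarrow> (nat \<Rightarrow>\<^sub>0 nat) \<Rightarrow> fock \<Rightarrow> fock" where
  "monomial_op_upto 0 k x = x"
| "monomial_op_upto (Suc N) k x = (e_op N ^^ Poly_Mapping.lookup k N) (monomial_op_upto N k x)"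

definition monomial_op :: "(nat \<Rightarrow>\<^sub>0 nat) \<Rightarrow> fock \<Rightarrow> fock" where
  "monomial_op k = monomial_op_upto (Suc (Max (insert 0 (Poly_Mapping.keys k)))) k"

definition B_op :: "B_ring \<Rightarrow> fock \<Rightarrow> fock" where
  "B_op p x = linear_ext (\<lambda>k. monomial_op k x) p"

lemma funpow_commute: "(\<And>x. f (g x) = g (f x)) \<Longrightarrow> f ((g ^^ n) x) = (g ^^ n) (f x)"
  by (induction n) simp_all

lemma e_op_monomial_op_upto: "e_op i (monomial_op_upto N k x) = monomial_op_upto N k (e_op i x)"
  by (induction N) (simp_all add: funpow_commute[of "e_op i"] e_op_commute)

lemma monomial_op_upto_add:
  "monomial_op_upto N (k + l) x = monomial_op_upto N k (monomial_op_upto N l x)"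
proof (induction N)
  case (Suc N)
  have "monomial_op_upto N k ((e_op N ^^ n) y) = (e_op N ^^ n) (monomial_op_upto N k y)" for n y
    by (rule funpow_commute) (simp add: e_op_monomial_op_upto)
  then show ?case by (simp add: Suc lookup_add funpow_add)
qed simp

text \<open>Variables outside the support act by zeroth powers, so two monomials can be compared at
  a common bound.\<close>

lemma monomial_op_eq_upto:
  assumes "Poly_Mapping.keys k \<subseteq> {..<N}"
  shows "monomial_op k x = monomial_op_upto N k x"
proof -
  let ?M = "Suc (Max (insert 0 (Poly_Mapping.keys k)))"
  have step: "monomial_op_upto (M + d) k x = monomial_op_upto M k x" if "Poly_Mapping.keys k \<subseteq> {..<M}" for M d
  proof (induction d)
    case (Suc d)
    have "M + d \<notin> Poly_Mapping.keys k" using that by auto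
    then have "Poly_Mapping.lookup k (M + d) = 0" by (simp add: in_keys_iff)
    then show ?case by (simp add: Suc)
  qed simp
  have "i < ?M" if "i \<in> Poly_Mapping.keys k" for i
    using that by (intro le_imp_less_Suc Max_ge) auto
  then have M: "Poly_Mapping.keys k \<subseteq> {..<?M}" by blast
  show ?thesis
    unfolding monomial_op_def
    using step[OF M, of "N - ?M"] step[OF assms, of "?M - N"] by (cases "N \<le> ?M") simp_all
qed

lemma keys_bounded: "\<exists>N. Poly_Mapping.keys (k :: nat \<Rightarrow>\<^sub>0 nat) \<subseteq> {..<N}"
  using finite_nat_set_iff_bounded[of "Poly_Mapping.keys k"] by auto

lemma monomial_op_add: "monomial_op (k + l) x = monomial_op k (monomial_op l x)"
proof -
  obtain N M where "Poly_Mapping.keys k \<subseteq> {..<N}" "Poly_Mapping.keys l \<subseteq> {..<M}"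
    using keys_bounded by meson
  then have "Poly_Mapping.keys k \<subseteq> {..<max N M}" "Poly_Mapping.keys l \<subseteq> {..<max N M}" by auto
  moreover from this have "Poly_Mapping.keys (k + l) \<subseteq> {..<max N M}" using keys_add[of k l] by blast
  ultimately show ?thesis by (simp add: monomial_op_eq_upto monomial_op_upto_add)
qed

lemma monomial_op_zero: "monomial_op 0 x = x"
  using monomial_op_eq_upto[of 0 0 x] by simp

lemma monomial_op_single: "monomial_op (Poly_Mapping.single i 1) x = e_op i x"
proof -
  have "monomial_op_upto N (Poly_Mapping.single i 1) x = x" if "N \<le> i" for N
    using that by (induction N) (simp_all add: lookup_single)
  then show ?thesis
    using monomial_op_eq_upto[of "Poly_Mapping.single i 1" "Suc i" x] by simp
qed

lemma monomial_op_diff: "monomial_op k (x - y) = monomial_op k x - monomial_op k y"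
proof -
  have pow: "(e_op N ^^ n) (x - y) = (e_op N ^^ n) x - (e_op N ^^ n) y" for N n x y
    by (induction n) (simp_all add: e_op_diff)
  have "monomial_op_upto N k (x - y) = monomial_op_upto N k x - monomial_op_upto N k y" for N
    by (induction N) (simp_all add: pow)
  then show ?thesis by (simp add: monomial_op_def)
qed

lemma additive_B_op_left: "Modules.additive (\<lambda>p. B_op p x)"
  unfolding B_op_def by (rule additive_linear_ext)

lemmas B_op_diff_left = Modules.additive.diff[OF additive_B_op_left]

lemma B_op_diff: "B_op p (x - y) = B_op p x - B_op p y"
proof (induction p rule: frag_induct)
  case (single k)
  show ?case by (simp add: B_op_def monomial_op_diff)
qed (simp add: B_op_diff_left)

lemma B_op_mult: "B_op (p * q) x = B_op p (B_op q x)"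
proof (induction p rule: frag_induct)
  case (single k)
  show ?case
  proof (induction q rule: frag_induct)
    case (single l)
    show ?case by (simp add: mult_single B_op_def monomial_op_add)
  qed (simp add: right_diff_distrib B_op_diff_left B_op_diff)
qed (simp add: left_diff_distrib B_op_diff_left)

lemma B_op_one: "B_op 1 x = x"
  unfolding B_op_def by (simp only: linear_ext_single monomial_op_zero flip: single_one)

lemma module_B_op: "Modules.module B_op"
proof
  fix p q :: B_ring and x y
  show "B_op p (x + y) = B_op p x + B_op p y"
    using B_op_diff[of p "x + y" y] by (simp add: algebra_simps)
qed (simp_all add: Modules.additive.add[OF additive_B_op_left] B_op_mult B_op_one)

lemma B_op_E_series: "B_op (fps_nth E_series j) x = bar_op (int j) x"
proof (cases j)
  case (Suc i)
  have e: "B_op (e_var j) x = e_op i x"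
    using monomial_op_single[of i x] by (simp add: Suc B_op_def e_var_def)
  show ?thesis
    using e Modules.additive.minus[OF additive_B_op_left]
    by (cases "even i") (simp_all add: Suc E_series_def e_op_def)
qed (simp add: E_series_def B_op_one)

lemma E_h_convolution:
  "(\<Sum>k = 0..n. fps_nth E_series k * h_poly (n - k)) = (if n = 0 then 1 else 0)"
  using arg_cong[OF h_poly_inverse, of "\<lambda>f. fps_nth f n"] by (simp add: fps_mult_nth)

text \<open>The h_n are determined by their convolution with E(z), and
  \<open>bar_plus_inverse\<close> is the same recursion for the coefficients of sigma_+; the term of
  index 0 isolates degree \<open>n\<close>.\<close>

lemma B_op_h_poly: "B_op (h_poly n) x = plus_op (int n) x"
proof (induction n rule: less_induct)
  case (less n)
  have "B_op (\<Sum>k = 0..n. fps_nth E_series k * h_poly (n - k)) x = (if n = 0 then x else 0)"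
    unfolding E_h_convolution
    using B_op_one Modules.additive.zero[OF additive_B_op_left] by simp
  then have "(\<Sum>k = 0..n. bar_op (int k) (B_op (h_poly (n - k)) x)) = (if n = 0 then x else 0)"
    by (simp add: Modules.additive.sum[OF additive_B_op_left] B_op_mult B_op_E_series)
  moreover have "(\<Sum>k = 0..n. bar_op (int k) (plus_op (int (n - k)) x)) = (if n = 0 then x else 0)"
    unfolding bar_plus_inverse[symmetric] by (intro sum.cong) (simp_all add: of_nat_diff)
  ultimately have "(\<Sum>k = 0..n. bar_op (int k) (B_op (h_poly (n - k)) x)) =
     (\<Sum>k = 0..n. bar_op (int k) (plus_op (int (n - k)) x))" by simp
  moreover have "(\<Sum>k = Suc 0..n. bar_op (int k) (B_op (h_poly (n - k)) x)) =
     (\<Sum>k = Suc 0..n. bar_op (int k) (plus_op (int (n - k)) x))"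
    by (intro sum.cong) (simp_all add: less)
  ultimately show ?case by (simp add: sum.atLeast_Suc_atMost)
qed

text \<open>The scalars on which the two actions agree form a subring. With the h_i it contains the
  coefficients of E(z), recursively since h_0 = 1, hence all variables and monomials.\<close>

lemma module_eqI_h_poly:
  assumes s: "Modules.module s" and s': "Modules.module s'"
    and h: "\<And>i x. s (h_poly i) x = s' (h_poly i) (x :: 'b::ab_group_add)"
  shows "s p x = s' p x"
proof -
  interpret s: Modules.module s by (rule s)
  interpret s': Modules.module s' by (rule s')
  define A where "A = {p. \<forall>x. s p x = s' p x}"
  have A_diff: "p - q \<in> A" if "p \<in> A" "q \<in> A" for p q
    using that by (simp add: A_def s.scale_left_diff_distrib s'.scale_left_diff_distrib)
  have A_mult: "p * q \<in> A" if "p \<in> A" "q \<in> A" for p q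
    using that by (simp add: A_def flip: s.scale_scale s'.scale_scale)
  have A_01: "0 \<in> A" "1 \<in> A" by (simp_all add: A_def)
  have A_minus: "- p \<in> A" if "p \<in> A" for p using A_diff[OF A_01(1) that] by simp
  have A_sum: "sum f I \<in> A" if "\<And>i. i \<in> I \<Longrightarrow> f i \<in> A" for f and I :: "nat set"
    using that A_01
  proof (induction I rule: infinite_finite_induct)
    case (insert i I)
    then have "f i - (- sum f I) \<in> A" by (intro A_diff A_minus) auto
    then show ?case using insert by simp
  qed simp_all
  have A_h: "h_poly i \<in> A" for i using h by (simp add: A_def)
  have h0: "h_poly 0 = 1" using E_h_convolution[of 0] by (simp add: E_series_def)
  have A_E: "fps_nth E_series n \<in> A" for n
  proof (induction n rule: less_induct)
    case (less n)
    have eq: "fps_nth E_series n = (if n = 0 then 1 else 0) - (\<Sum>k<n. fps_nth E_series k * h_poly (n - k))"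
      unfolding E_h_convolution[symmetric] using h0
      by (simp add: sum.last_plus atLeast0AtMost flip: lessThan_Suc_atMost)
    have "(\<Sum>k<n. fps_nth E_series k * h_poly (n - k)) \<in> A"
      by (intro A_sum A_mult A_h) (simp add: less)
    moreover have "(if n = 0 then 1 else 0) \<in> A" using A_01 by simp
    ultimately show ?case by (subst eq) (rule A_diff)
  qed
  have A_e: "Poly_Mapping.single (Poly_Mapping.single i 1) 1 \<in> A" for i
    using A_E[of "Suc i"] A_minus[OF A_E[of "Suc i"]]
    by (cases "even i") (simp_all add: E_series_def e_var_def)
  have A_add: "Poly_Mapping.single (k + l) 1 \<in> A"
    if "Poly_Mapping.single k 1 \<in> A" "Poly_Mapping.single l 1 \<in> A" for k l
    using A_mult[OF that] by (simp add: mult_single)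
  have A_power: "Poly_Mapping.single (Poly_Mapping.single i n) 1 \<in> A" for i n
  proof (induction n)
    case 0
    show ?case using A_01 by (simp add: single_one)
  next
    case (Suc n)
    show ?case using A_add[OF A_e[of i] Suc] by (simp flip: single_add)
  qed
  have "Poly_Mapping.single k 1 \<in> A" for k
  proof (induction k rule: update_induct)
    case const
    show ?case using A_01 by (simp add: single_one)
  next
    case (update f a b)
    have "Poly_Mapping.update a b f = Poly_Mapping.single a b + f"
      using update(1) by (intro poly_mapping_eqI)
        (auto simp: lookup_update lookup_add lookup_single when_def in_keys_iff)
    then show ?case using A_add[OF A_power update(3)] by simp
  qed
  then have "p \<in> A"
    by (induction p rule: frag_induct) (simp_all add: A_diff)
  then show ?thesis by (simp add: A_def)
qed

lemma B_act_eq: "B_act = B_op"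
  unfolding B_act_def
proof (rule the_equality)
  show *: "Modules.module B_op \<and> (\<forall>i u. B_op (h_poly i) u = fps_nth (fock_sigma_plus u) i)"
    using module_B_op B_op_h_poly by (simp add: plus_op_def fps_at_def)
  fix s
  assume s: "Modules.module s \<and> (\<forall>i u. s (h_poly i) u = fps_nth (fock_sigma_plus u) i)"
  have "s p x = B_op p x" for p x
    by (rule module_eqI_h_poly) (simp_all only: * s)
  then show "s = B_op" by blast
qed

lemma E_act_eq: "E_act u = series_z (fock_sigma_plus_bar u)"
  unfolding E_act_def B_act_eq B_op_E_series
  by (rule arg_cong[of _ _ series_z], rule fps_ext) (simp add: bar_op_def fps_at_def)

section \<open>Contraction and the inverse of \<open>R(z)\<close> on the Fock space\<close>

text \<open>The letters m, m - 1, ..., j, whose wedge lowers the vacuum to index j - 1; none when m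
  < j.\<close>

definition descending :: "int \<Rightarrow> int \<Rightarrow> int list" where
  "descending j m = map (\<lambda>i. m - int i) [0..<nat (m - j + 1)]"

lemma descending_Cons: "j \<le> m \<Longrightarrow> descending j m = m # descending j (m - 1)"
proof -
  assume "j \<le> m"
  then have "nat (m - j + 1) = Suc (nat (m - 1 - j + 1))" by simp
  then show ?thesis by (simp add: descending_def map_upt_Suc diff_diff_eq del: upt_Suc)
qed

lemma descending_Nil: "m < j \<Longrightarrow> descending j m = []"
  by (simp add: descending_def)

lemma vac_eq_descending: "vac m = wedge (gens (descending j m)) (vac (min m (j - 1)))"
  using vac_eq_wedge[of m "nat (m - j + 1)"]
  by (cases "m < j") (simp_all add: descending_def min_def wedge_simps)

text \<open>The vacuum is first lowered below \<open>j\<close>, so that a \<open>gen j\<close>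
  hidden in it becomes visible to \<open>iota\<close>.\<close>

definition fock_iota :: "int \<Rightarrow> fock \<Rightarrow> fock" where
  "fock_iota j = (SOME T. Modules.additive T \<and>
     (\<forall>m u. T (wedge u (vac m)) = wedge (iota j (u * gens (descending j m))) (vac (min m (j - 1)))))"

lemma
  shows additive_fock_iota: "Modules.additive (fock_iota j)"
    and fock_iota_wedge_vac:
      "fock_iota j (wedge u (vac m)) = wedge (iota j (u * gens (descending j m))) (vac (min m (j - 1)))"
proof -
  let ?g = "\<lambda>m u. wedge (iota j (u * gens (descending j m))) (vac (min m (j - 1)))"
  have "\<exists>T. Modules.additive T \<and> (\<forall>m u. T (wedge u (vac m)) = ?g m u)"
  proof (rule fock_lift_exists)
    fix m u
    show "Modules.additive (?g m)"
      by (simp add: Modules.additive_def distrib_right iota_add wedge_simps)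
    show "?g (m - 1) (u * gen m) = ?g m u"
    proof (cases "j \<le> m")
      case True
      then show ?thesis by (simp add: descending_Cons[of j m] mult.assoc)
    next
      case False
      then show ?thesis
        by (simp add: descending_Nil iota_mult_gen wedge_mult wedge_gen_vac)
    qed
    show "?g m (u * gen m) = 0"
    proof (cases "j \<le> m")
      case True
      then show ?thesis by (simp add: descending_Cons[of j m] mult.assoc)
    next
      case False
      then show ?thesis
        by (simp add: descending_Nil iota_mult_gen wedge_mult wedge_gen_vac)
    qed
  qed
  from someI_ex[OF this, folded fock_iota_def]
  show "Modules.additive (fock_iota j)" "fock_iota j (wedge u (vac m)) = ?g m u" by simp_all
qed

lemma fock_iota_wedge:
  "fock_iota j (wedge (gen i) x) = (if i = j then x else 0) - wedge (gen i) (fock_iota j x)"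
proof (induction x rule: fock_induct)
  case (gens xs m)
  have "fock_iota j (wedge (gen i) (wedge (gens xs) (vac m))) =
      wedge (iota j (gen i * (gens xs * gens (descending j m)))) (vac (min m (j - 1)))"
    by (simp add: fock_iota_wedge_vac mult.assoc flip: wedge_mult)
  also have "\<dots> = (if i = j then wedge (gens xs) (wedge (gens (descending j m)) (vac (min m (j - 1)))) else 0)
      - wedge (gen i) (fock_iota j (wedge (gens xs) (vac m)))"
    by (simp add: iota_gen_mult wedge_simps wedge_mult fock_iota_wedge_vac)
  finally show ?case by (simp only: vac_eq_descending[symmetric])
qed (auto simp: wedge_simps Modules.additive.diff[OF additive_fock_iota])

lemma fock_iota_low: "m < j \<Longrightarrow> fock_iota j (wedge u (vac m)) = wedge (iota j u) (vac m)"
  by (simp add: fock_iota_wedge_vac descending_Nil)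

text \<open>The bound on \<open>r\<close> puts the vacuum index \<open>m - r\<close> below
  \<open>j\<close>, where contraction only sees the exterior factor; spanning gives
  uniqueness.\<close>

lemma fock_contract_eq: "fock_contract j = fock_iota j"
  unfolding fock_contract_def
proof (rule the_equality)
  show C: "Modules.additive (fock_iota j) \<and>
     (\<forall>m lam r. is_partition lam \<longrightarrow> int r > max (int (length lam)) (m - j) \<longrightarrow>
        fock_iota j (fock_basis m lam) = wedge (contract r (gen j) (b_wedge r m lam)) (vac (m - int r)))"
  proof (intro conjI allI impI additive_fock_iota)
    fix m :: int and lam :: "nat list" and r :: nat
    assume r: "int r > max (int (length lam)) (m - j)"
    have "contract r (gen j) (b_wedge r m lam) = iota j (b_wedge r m lam)"
      using r by (intro contract_eq_iota) (auto simp: b_wedge_def intro!: gens_in_ext_power)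
    then show "fock_iota j (fock_basis m lam) = wedge (contract r (gen j) (b_wedge r m lam)) (vac (m - int r))"
      using r by (simp add: fock_basis_eq[of lam r] fock_iota_low)
  qed
  fix C'
  assume C': "Modules.additive C' \<and>
     (\<forall>m lam r. is_partition lam \<longrightarrow> int r > max (int (length lam)) (m - j) \<longrightarrow>
        C' (fock_basis m lam) = wedge (contract r (gen j) (b_wedge r m lam)) (vac (m - int r)))"
  show "C' = fock_iota j"
  proof
    fix x
    show "C' x = fock_iota j x"
    proof (induction x rule: fock_basis_induct)
      case (basis m lam)
      define r where "r = Suc (max (length lam) (nat (m - j)))"
      have "int r > max (int (length lam)) (m - j)" by (auto simp: r_def)
      then show ?case using basis C C' by simp
    next
      case (diff x y)
      then show ?case using C' by (simp add: Modules.additive.diff additive_fock_iota)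
    qed
  qed
qed

section \<open>The coefficients of the inverse of R(z)\<close>

definition shift_part :: "int \<Rightarrow> int ext \<Rightarrow> int ext" where
  "shift_part d = ext_lift (\<lambda>xs. if int (length xs) = d then gens (map (\<lambda>i. i - 1) xs) else 0)"

lemma alternating_shift_part:
  "alternating (\<lambda>xs. if int (length xs) = d then gens (map (\<lambda>i. i - 1 :: int) xs) else 0)"
proof -
  have "gens xs * (gen i * (gen j * gens ys)) + gens xs * (gen j * (gen i * gens ys)) = 0"
    for xs ys and i j :: int
    using gen_anticomm_left[of i j "gens ys"] by simp
  then show ?thesis by (simp add: alternating_def)
qed

lemma additive_shift_part: "Modules.additive (shift_part d)"
  unfolding shift_part_def by (rule additive_ext_lift) (rule alternating_shift_part)

lemma shift_part_gens:
  "shift_part d (gens xs) = (if int (length xs) = d then gens (map (\<lambda>i. i - 1) xs) else 0)"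
  unfolding shift_part_def by (rule ext_lift_gens[OF alternating_shift_part])

lemma shift_part_gen_mult: "shift_part d (gen i * u) = gen (i - 1) * shift_part (d - 1) u"
proof (induction u rule: ext_induct)
  case (gens xs)
  then show ?case using shift_part_gens[of d "i # xs"] by (auto simp: shift_part_gens)
qed (simp add: right_diff_distrib Modules.additive.diff[OF additive_shift_part])

lemma shift_part_mult_gen: "shift_part d (u * gen i) = shift_part (d - 1) u * gen (i - 1)"
proof (induction u rule: ext_induct)
  case (gens xs)
  then show ?case using shift_part_gens[of d "xs @ [i]"] by (auto simp: shift_part_gens)
qed (simp add: left_diff_distrib Modules.additive.diff[OF additive_shift_part])

text \<open>The coefficient of z^n in R(z)^{-1}: it selects charge -n and lowers every index by 1.
  An exterior factor of degree d over the vacuum \<open>m\<close> has charge d + m, hence the degree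
  \<open>- n - m\<close>.\<close>

definition rinv :: "int \<Rightarrow> fock \<Rightarrow> fock" where
  "rinv n = (SOME T. Modules.additive T \<and>
     (\<forall>m u. T (wedge u (vac m)) = wedge (shift_part (- n - m) u) (vac (m - 1))))"

lemma
  shows additive_rinv: "Modules.additive (rinv n)"
    and rinv_wedge_vac: "rinv n (wedge u (vac m)) = wedge (shift_part (- n - m) u) (vac (m - 1))"
proof -
  let ?g = "\<lambda>m u. wedge (shift_part (- n - m) u) (vac (m - 1))"
  have "\<exists>T. Modules.additive T \<and> (\<forall>m u. T (wedge u (vac m)) = ?g m u)"
  proof (rule fock_lift_exists)
    fix m u
    show "Modules.additive (?g m)"
      by (simp add: Modules.additive_def Modules.additive.add[OF additive_shift_part] wedge_simps)
    show "?g (m - 1) (u * gen m) = ?g m u"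
      using wedge_gen_vac(1)[of "m - 1"] by (simp add: shift_part_mult_gen wedge_mult)
    show "?g m (u * gen m) = 0"
      by (simp add: shift_part_mult_gen wedge_mult wedge_gen_vac)
  qed
  from someI_ex[OF this, folded rinv_def]
  show "Modules.additive (rinv n)" "rinv n (wedge u (vac m)) = ?g m u" by simp_all
qed

lemmas rinv_diff = Modules.additive.diff[OF additive_rinv]
  and rinv_add = Modules.additive.add[OF additive_rinv]
  and rinv_minus = Modules.additive.minus[OF additive_rinv]
  and rinv_sum = Modules.additive.sum[OF additive_rinv]
  and rinv_zero [simp] = Modules.additive.zero[OF additive_rinv]

lemma rinv_wedge: "rinv n (wedge (gen i) x) = wedge (gen (i - 1)) (rinv (n + 1) x)"
proof (induction x rule: fock_induct)
  case (gens xs m)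
  have "- n - m - 1 = - (n + 1) - m" by simp
  then show ?case
    by (simp only: wedge_mult[symmetric] rinv_wedge_vac shift_part_gen_mult)
qed (simp add: wedge_simps rinv_diff)

lemma rinv_vac: "rinv n (vac m) = (if n = - m then vac (m - 1) else 0)"
  using rinv_wedge_vac[of n 1 m] shift_part_gens[of "- n - m" "[]"]
  by (auto simp: wedge_simps)

lemma rinv_fock_basis: "rinv n (fock_basis m lam) = (if n = - m then fock_basis (m - 1) lam else 0)"
proof -
  let ?r = "length lam"
  have "map (\<lambda>i. i - 1) (map (\<lambda>i. m - int i + int (part lam i)) [0..<?r]) =
      map (\<lambda>i. m - 1 - int i + int (part lam i)) [0..<?r]"
    by simp
  then have "shift_part (- n - (m - int ?r)) (b_wedge ?r m lam) = (if n = - m then b_wedge ?r (m - 1) lam else 0)"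
    by (auto simp add: b_wedge_def shift_part_gens simp del: map_map)
  then have "rinv n (fock_basis m lam) =
      (if n = - m then wedge (b_wedge ?r (m - 1) lam) (vac (m - int ?r - 1)) else 0)"
    by (simp add: fock_basis_def rinv_wedge_vac)
  then show ?thesis by (simp add: fock_basis_def algebra_simps)
qed

lemma R_inv_eq: "R_inv = (\<lambda>x n. rinv n x)"
  unfolding R_inv_def
proof (rule the_equality)
  show R: "(\<forall>n. Modules.additive (\<lambda>u. rinv n u)) \<and> (\<forall>m lam. is_partition lam \<longrightarrow>
        (\<lambda>n. rinv n (fock_basis m lam)) = (\<lambda>n. if n = - m then fock_basis (m - 1) lam else 0))"
    by (simp add: additive_rinv rinv_fock_basis)
  fix A
  assume A: "(\<forall>n. Modules.additive (\<lambda>u. A u n)) \<and> (\<forall>m lam. is_partition lam \<longrightarrow>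
        A (fock_basis m lam) = (\<lambda>n. if n = - m then fock_basis (m - 1) lam else 0))"
  have "A x n = rinv n x" for x n
  proof (induction x rule: fock_basis_induct)
    case (basis m lam)
    then show ?case using A by (simp add: rinv_fock_basis)
  next
    case (diff x y)
    have "Modules.additive (\<lambda>u. A u n)" using A by blast
    from Modules.additive.diff[OF this, of x y] show ?case by (simp add: diff rinv_diff)
  qed
  then show "A = (\<lambda>x n. rinv n x)" by blast
qed

lemma rinv_bar_vac: "rinv n (bar_vac j m) = (if n = - m then bar_vac j (m - 1) else 0)"
  by (induction j arbitrary: n m) (auto simp: bar_vac_simps rinv_vac rinv_minus rinv_wedge)

lemma rinv_bar_op: "rinv n (bar_op k x) = bar_op k (rinv n x)"
proof (induction x arbitrary: n rule: fock_induct)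
  case (gens xs m)
  show ?case
  proof (induction xs arbitrary: n k)
    case Nil
    show ?case by (simp add: wedge_simps bar_op_vac rinv_vac rinv_bar_vac)
  qed (simp add: wedge_mult bar_op_wedge rinv_diff rinv_wedge)
qed (simp add: bar_op_diff rinv_diff)

text \<open>The recursion for \<open>minus_op\<close> returns a wedge of the same length with
  smaller first index, so an induction on the exponent is nested inside the one on the word.\<close>

lemma rinv_minus_op: "rinv n (minus_op k x) = minus_op k (rinv n x)"
proof (induction x arbitrary: n rule: fock_induct)
  case (gens xs m)
  show ?case
  proof (induction xs arbitrary: n k)
    case Nil
    show ?case by (simp add: wedge_simps minus_op_vac rinv_vac)
  next
    case (Cons i xs)
    let ?x = "wedge (gens xs) (vac m)"
    \<comment> \<open>Writing the exponent as \<open>int d - 1\<close> starts the inner induction at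
      -1, where both sides are zero.\<close>
    have "rinv n (minus_op (int d - 1) (wedge (gen i) ?x)) = minus_op (int d - 1) (rinv n (wedge (gen i) ?x))"
      for d i n
    proof (induction d arbitrary: i)
      case (Suc d)
      have *: "int (Suc d) - 1 - 1 = int d - 1" by simp
      show ?case
        unfolding minus_op_wedge[of "int (Suc d) - 1"] rinv_wedge[of n i] rinv_add *
        by (simp only: Suc Cons) (simp only: rinv_wedge Cons)
    qed simp
    from this[where d = "nat (k + 1)"] show ?case
      by (cases "k < 0") (simp_all add: wedge_mult)
  qed
qed (simp add: minus_op_diff rinv_diff)

section \<open>The composite of \<open>\<sigma>\<^sub>-\<close> and the inverse of \<open>\<sigma>\<^sub>+\<close>\<close>

text \<open>The coefficient of z^N in \<Gamma>(x); \<open>n\<close> is the power of z contributed by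
  sigma_-(z).\<close>

definition bar_minus :: "fock \<Rightarrow> int \<Rightarrow> fock" where
  "bar_minus x N = Sum_any (\<lambda>n. bar_op (N - n) (minus_op (- n) x))"

lemma apply_sigma_bar:
  "apply_coeffwise (\<lambda>u. series_z (fock_sigma_plus_bar u)) (series_zinv (fock_sigma_minus x)) = bar_minus x"
proof
  fix N
  have "series_z (fock_sigma_plus_bar (series_zinv (fock_sigma_minus x) n)) (N - n) =
      bar_op (N - n) (minus_op (- n) x)" for n
    by (simp add: series_z_def series_zinv_def bar_op_def minus_op_def fps_at_def)
  then show "apply_coeffwise (\<lambda>u. series_z (fock_sigma_plus_bar u)) (series_zinv (fock_sigma_minus x)) N
      = bar_minus x N"
    by (simp add: apply_coeffwise_def bar_minus_def)
qed

lemma minus_op_eventually_zero: "\<exists>K. \<forall>k\<ge>K. minus_op k x = 0"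
proof (induction x rule: fock_induct)
  case (gens xs m)
  show ?case
  proof (induction xs)
    case Nil
    show ?case by (rule exI[of _ 1]) (simp add: wedge_simps minus_op_vac)
  next
    case (Cons i xs)
    let ?x = "wedge (gens xs) (vac m)"
    from Cons obtain K where K: "\<And>k. K \<le> k \<Longrightarrow> minus_op k ?x = 0" by blast
    \<comment> \<open>\<open>a\<close> bounds how far the letter lies above the vacuum; each step
      lowers it together with the exponent, until the wedge itself is zero.\<close>
    have vanish: "minus_op k (wedge (gen i) ?x) = 0" if "K + int a \<le> k" "i \<le> m + int a" for a k i
      using that
    proof (induction a arbitrary: k i)
      case 0
      then show ?case by (simp add: wedge_gens_low)
    next
      case (Suc a)
      have "minus_op (k - 1) (wedge (gen (i - 1)) ?x) = 0"
        by (rule Suc.IH) (use Suc.prems in simp_all)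
      moreover have "minus_op k ?x = 0" by (rule K) (use Suc.prems in simp)
      ultimately show ?case by (subst minus_op_wedge) simp
    qed
    have "\<forall>k\<ge>K + int (nat (i - m)). minus_op k (wedge (gen i) ?x) = 0"
      by (intro allI impI, rule vanish[of "nat (i - m)"]) auto
    then show ?case by (auto simp: wedge_mult)
  qed
next
  case (diff x y)
  then obtain K L where "\<forall>k\<ge>K. minus_op k x = 0" "\<forall>k\<ge>L. minus_op k y = 0" by blast
  then show ?case by (intro exI[of _ "max K L"]) (simp add: minus_op_diff)
qed

text \<open>The freedom in the range \<open>A\<close> lets several series be summed over a common
  range.\<close>

lemma bar_minus_eq_sum:
  assumes "\<And>k. k \<ge> K \<Longrightarrow> minus_op k x = 0" "finite A" "{- K..0} \<subseteq> A"
  shows "bar_minus x N = (\<Sum>n\<in>A. bar_op (N - n) (minus_op (- n) x))"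
  unfolding bar_minus_def
proof (rule Sum_any.expand_superset[OF assms(2)])
  show "{n. bar_op (N - n) (minus_op (- n) x) \<noteq> 0} \<subseteq> A"
  proof
    fix n
    assume n: "n \<in> {n. bar_op (N - n) (minus_op (- n) x) \<noteq> 0}"
    then have "\<not> K \<le> - n" using assms(1)[of "- n"] by auto
    moreover have "\<not> n > 0" using n by auto
    ultimately have "n \<in> {- K..0}" by auto
    then show "n \<in> A" using assms(3) by blast
  qed
qed

lemma bar_minus_zero: "bar_minus 0 N = 0"
  by (simp add: bar_minus_def)

lemma bar_minus_uminus: "bar_minus (- x) N = - bar_minus x N"
proof -
  obtain K where K: "\<forall>k\<ge>K. minus_op k x = 0" using minus_op_eventually_zero by blast
  have minus: "minus_op k (- x) = - minus_op k x" for k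
    by (rule Modules.additive.minus[OF additive_ops(1)])
  have "bar_minus x N = (\<Sum>n\<in>{- K..0}. bar_op (N - n) (minus_op (- n) x))"
    by (rule bar_minus_eq_sum[of K]) (use K in auto)
  moreover have "bar_minus (- x) N = (\<Sum>n\<in>{- K..0}. bar_op (N - n) (minus_op (- n) (- x)))"
    by (rule bar_minus_eq_sum[of K]) (use K minus in auto)
  ultimately show ?thesis by (simp add: minus bar_op_minus sum_negf)
qed

text \<open>Apply the inverse of sigma_+ to \<open>minus_op_wedge\<close>: the factor z^{-1} moves
  one term to the coefficient N + 1, and the other term splits by
  \<open>bar_op_wedge\<close>.\<close>

lemma bar_minus_wedge:
  "bar_minus (wedge (gen i) x) N = bar_minus (wedge (gen (i - 1)) x) (N + 1)
     + wedge (gen i) (bar_minus x N) - wedge (gen (i + 1)) (bar_minus x (N - 1))"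
proof -
  let ?y = "wedge (gen (i - 1)) x" and ?z = "wedge (gen i) x"
  obtain K L M where KLM: "\<forall>k\<ge>K. minus_op k x = 0" "\<forall>k\<ge>L. minus_op k ?y = 0"
    "\<forall>k\<ge>M. minus_op k ?z = 0"
    using minus_op_eventually_zero by meson
  define S where "S = max K (max L M)"
  have S: "minus_op k x = 0" "minus_op k ?y = 0" "minus_op k ?z = 0" if "k \<ge> S" for k
    using that KLM by (simp_all add: S_def)
  \<comment> \<open>The extra place at the lower end leaves room for the shift of the summation
    index.\<close>
  let ?A = "{- S - 1..0}"
  have "bar_op (N - n) (minus_op (- n) ?z) = bar_op (N - n) (minus_op (- n - 1) ?y)
      + wedge (gen i) (bar_op (N - n) (minus_op (- n) x))
      - wedge (gen (i + 1)) (bar_op (N - 1 - n) (minus_op (- n) x))" for n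
  proof -
    have "N - n - 1 = N - 1 - n" by simp
    then show ?thesis by (subst minus_op_wedge) (simp only: bar_op_add bar_op_wedge, simp)
  qed
  moreover have "bar_minus ?z N = (\<Sum>n\<in>?A. bar_op (N - n) (minus_op (- n) ?z))"
    by (rule bar_minus_eq_sum[of S]) (use S in auto)
  moreover have "bar_minus x N = (\<Sum>n\<in>?A. bar_op (N - n) (minus_op (- n) x))" for N
    by (rule bar_minus_eq_sum[of S]) (use S in auto)
  moreover have "bar_minus ?y (N + 1) = (\<Sum>n\<in>?A. bar_op (N - n) (minus_op (- n - 1) ?y))"
  proof -
    have "bar_minus ?y (N + 1) = (\<Sum>n\<in>{- S..1}. bar_op (N + 1 - n) (minus_op (- n) ?y))"
      by (rule bar_minus_eq_sum[of S]) (use S in auto)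
    also have "\<dots> = (\<Sum>n\<in>?A. bar_op (N - n) (minus_op (- n - 1) ?y))"
      by (rule sum.reindex_bij_witness[of _ "\<lambda>n. n + 1" "\<lambda>n. n - 1"]) (auto simp: algebra_simps)
    finally show ?thesis .
  qed
  ultimately show ?thesis
    by (simp add: sum.distrib sum_subtractf wedge_sum)
qed

text \<open>
  For \<open>x\<close> of charge \<open>m\<close>, the coefficient \<open>charge_part m x (m - j)\<close> is going to be
  \<open>\<beta>\<^sub>j \<lrcorner> x\<close>; accordingly, \<open>anticommutator m i x\<close> measures its failure to
  anticommute with \<open>gen i\<close>, and is to be a single power of \<open>z\<close> times \<open>x\<close>.
\<close>

definition charge_part :: "int \<Rightarrow> fock \<Rightarrow> int \<Rightarrow> fock" where
  "charge_part m x N = rinv (- m) (bar_minus x N)"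

definition anticommutator :: "int \<Rightarrow> int \<Rightarrow> fock \<Rightarrow> int \<Rightarrow> fock" where
  "anticommutator m i x N = charge_part (m + 1) (wedge (gen i) x) N + wedge (gen i) (charge_part m x (N - 1))"

text \<open>This exhibits a coefficient of \<Delta>_i(x) inside \<open>rinv\<close>: pulling
  \<open>gen i\<close> into it raises the index to \<open>i + 1\<close>.\<close>

lemma anticommutator_eq_rinv:
  "anticommutator m i x N =
     rinv (- (m + 1)) (bar_minus (wedge (gen i) x) N + wedge (gen (i + 1)) (bar_minus x (N - 1)))"
  by (simp add: anticommutator_def charge_part_def rinv_add rinv_wedge)

text \<open>Rearranging \<open>bar_minus_wedge\<close> lowers \<open>i\<close> by 1 while raising N
  by 1, so only N + i matters.\<close>

lemma anticommutator_shift: "anticommutator m i x N = anticommutator m 0 x (N + i)"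
proof -
  have step: "anticommutator m i x N = anticommutator m (i - 1) x (N + 1)" for i N
    unfolding anticommutator_eq_rinv by (simp add: bar_minus_wedge[of i])
  show ?thesis
  proof (induction i arbitrary: N rule: int_induct[of _ 0])
    case (step1 i)
    then show ?case using step[of "i + 1" N] by (simp add: ac_simps)
  next
    case (step2 i)
    then show ?case using step[of i "N - 1"] by (simp add: algebra_simps)
  qed simp
qed

text \<open>Terms with both generators inside \<open>charge_part\<close>, or both outside it, are
  antisymmetric in the two and cancel; the mixed terms agree.\<close>

lemma anticommutator_wedge:
  "anticommutator (m + 1) i (wedge (gen k) x) N + anticommutator (m + 1) k (wedge (gen i) x) N =
     wedge (gen i) (anticommutator m k x (N - 1)) + wedge (gen k) (anticommutator m i x (N - 1))"
proof -
  have "charge_part (m + 2) (wedge (gen i) (wedge (gen k) x)) N =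
      - charge_part (m + 2) (wedge (gen k) (wedge (gen i) x)) N"
    by (simp add: charge_part_def wedge_gen_anticomm[of i k] bar_minus_uminus rinv_minus)
  moreover have "wedge (gen i) (wedge (gen k) y) = - wedge (gen k) (wedge (gen i) y)" for y
    by (rule wedge_gen_anticomm)
  ultimately show ?thesis
    by (simp add: anticommutator_def wedge_simps add.assoc)
qed

lemma anticommutator_vac:
  "anticommutator m i (vac m) N = (if N + i = m + 1 then vac m else 0)"
proof -
  have vac: "bar_minus (vac m) N = bar_op N (vac m)" for m N
  proof -
    have "bar_minus (vac m) N = (\<Sum>n\<in>{0}. bar_op (N - n) (minus_op (- n) (vac m)))"
      unfolding bar_minus_def by (rule Sum_any.expand_superset) (auto simp: minus_op_vac)
    then show ?thesis by (simp add: minus_op_vac)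
  qed
  \<comment> \<open>At index \<open>m + 1\<close> the wedge is again a vacuum and the
    \<open>gen (m + 2)\<close> terms cancel; the shift rule carries the result to every
    index.\<close>
  have "anticommutator m (m + 1) (vac m) N = (if N = 0 then vac m else 0)" for N
  proof -
    have "wedge (gen (m + 1)) (vac m) = vac (m + 1)" using wedge_gen_vac(1)[of "m + 1"] by simp
    then have "bar_minus (wedge (gen (m + 1)) (vac m)) N = bar_op N (wedge (gen (m + 1)) (vac m))"
      by (simp add: vac)
    then have "anticommutator m (m + 1) (vac m) N =
        rinv (- (m + 1)) (wedge (gen (m + 1)) (bar_op N (vac m)))"
      by (simp add: anticommutator_eq_rinv vac bar_op_wedge)
    also have "wedge (gen (m + 1)) (bar_op N (vac m)) = (if N = 0 then vac (m + 1) else 0)"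
      using wedge_gen_bar_vac(1)[of "m + 1" "nat N"] by (auto simp: bar_op_vac)
    finally show ?thesis by (simp add: rinv_vac)
  qed
  from this[of "N + i - (m + 1)"] show ?thesis
    using anticommutator_shift[of m i "vac m" N] anticommutator_shift[of m "m + 1" "vac m" "N + i - (m + 1)"]
    by auto
qed

lemma anticommutator_eq:
  assumes "m = k + int (length xs)"
  shows "anticommutator m i (wedge (gens xs) (vac k)) N =
     (if N + i = m + 1 then wedge (gens xs) (vac k) else 0)"
  using assms
proof (induction xs arbitrary: m i N)
  case Nil
  then show ?case by (simp add: wedge_simps anticommutator_vac)
next
  case (Cons j xs)
  let ?x = "wedge (gens xs) (vac k)"
  define m' where "m' = k + int (length xs)"
  have m: "m = m' + 1" using Cons.prems by (simp add: m'_def)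
  \<comment> \<open>Since \<open>gen a\<close> kills \<open>?x\<close>, the relation
    \<open>anticommutator_wedge\<close> has a single unknown term; the shift rule then passes from
    \<open>a\<close> to \<open>i\<close>.\<close>
  obtain a where a: "wedge (gen a) ?x = 0" using gen_eventually_kills[of ?x] by blast
  have zero: "anticommutator (m' + 1) j 0 N = 0" for N
    by (simp add: anticommutator_def charge_part_def bar_minus_zero)
  have "anticommutator (m' + 1) a (wedge (gen j) ?x) N =
      (if N + a = m' + 2 then wedge (gen j) ?x else 0)" for N
    using anticommutator_wedge[of m' a j ?x N] by (auto simp: a zero Cons.IH[OF m'_def])
  from this[of "N + i - a"] show ?case
    using anticommutator_shift[of "m' + 1" i "wedge (gen j) ?x" N]
      anticommutator_shift[of "m' + 1" a "wedge (gen j) ?x" "N + i - a"]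
    by (auto simp: m wedge_mult)
qed

text \<open>Both sides obey the same Leibniz recursion, by \<open>anticommutator_eq\<close> and
  \<open>fock_iota_wedge\<close>. On the vacuum \<open>k < j\<close> makes the exponent negative,
  where the series has no term.\<close>

lemma charge_part_eq_fock_iota:
  assumes "k < j"
  shows "charge_part (k + int (length xs)) (wedge (gens xs) (vac k)) (k + int (length xs) - j) =
     fock_iota j (wedge (gens xs) (vac k))"
proof (induction xs)
  case Nil
  have "bar_op (k - j - n) (minus_op (- n) (vac k)) = 0" for n
    using assms by (cases "n = 0") (simp_all add: minus_op_vac)
  then have "bar_minus (vac k) (k - j) = 0" by (simp add: bar_minus_def)
  then show ?case
    using fock_iota_low[OF assms, of 1] by (simp add: charge_part_def wedge_simps)
next
  case (Cons i xs)
  let ?x = "wedge (gens xs) (vac k)" and ?m = "k + int (length xs)"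
  have "charge_part (?m + 1) (wedge (gen i) ?x) (?m + 1 - j) =
      anticommutator ?m i ?x (?m + 1 - j) - wedge (gen i) (charge_part ?m ?x (?m - j))"
  proof -
    have "?m + 1 - j - 1 = ?m - j" by simp
    then show ?thesis unfolding anticommutator_def by (simp only: add_diff_cancel)
  qed
  also have "\<dots> = (if i = j then ?x else 0) - wedge (gen i) (fock_iota j ?x)"
    by (simp only: anticommutator_eq[OF refl] Cons) simp
  also have "\<dots> = fock_iota j (wedge (gen i) ?x)" by (rule fock_iota_wedge[symmetric])
  finally show ?case by (simp add: wedge_mult ac_simps)
qed

text \<open>Both coefficient operators commute with \<open>rinv\<close>, so they create no component
  of a charge that \<open>x\<close> lacks.\<close>

lemma rinv_bar_minus:
  assumes "rinv n x = 0"
  shows "rinv n (bar_minus x N) = 0"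
proof -
  obtain K where K: "\<forall>k\<ge>K. minus_op k x = 0" using minus_op_eventually_zero by blast
  have "bar_minus x N = (\<Sum>n\<in>{- K..0}. bar_op (N - n) (minus_op (- n) x))"
    by (rule bar_minus_eq_sum[of K]) (use K in auto)
  then show ?thesis by (simp add: rinv_sum rinv_bar_op rinv_minus_op assms)
qed

lemma beta_contract_fock_basis:
  "beta_contract (fock_basis m lam) = z_power (- 1) (apply_coeffwise R_inv (bar_minus (fock_basis m lam)))"
proof
  fix n :: int
  let ?x = "fock_basis m lam" and ?j = "- n - 1"
  \<comment> \<open>A vector of charge \<open>m\<close> is seen by \<open>rinv\<close> only at index
    \<open>- m\<close>, which leaves the single term k = n + 1 + m.\<close>
  have "apply_coeffwise R_inv (bar_minus ?x) (n + 1) =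
      (\<Sum>k\<in>{n + 1 + m}. rinv (n + 1 - k) (bar_minus ?x k))"
    unfolding apply_coeffwise_def R_inv_eq
  proof (rule Sum_any.expand_superset)
    show "{k. rinv (n + 1 - k) (bar_minus ?x k) \<noteq> 0} \<subseteq> {n + 1 + m}"
    proof -
      have "rinv (n + 1 - k) (bar_minus ?x k) = 0" if "k \<noteq> n + 1 + m" for k
        by (rule rinv_bar_minus) (use that in \<open>simp add: rinv_fock_basis\<close>)
      then show ?thesis by blast
    qed
  qed simp
  also have "\<dots> = charge_part m ?x (m - ?j)" by (simp add: charge_part_def algebra_simps)
  also have "\<dots> = fock_iota ?j ?x"
  proof -
    \<comment> \<open>\<open>r\<close> covers all parts and puts the vacuum index
      \<open>m - int r\<close> below the contracted index \<open>?j\<close>.\<close>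
    define r where "r = max (length lam) (nat (m - ?j + 1))"
    have "?x = wedge (b_wedge r m lam) (vac (m - int r))" by (rule fock_basis_eq) (simp add: r_def)
    moreover have "m - int r < ?j" by (auto simp: r_def max_def)
    ultimately show ?thesis
      using charge_part_eq_fock_iota[of "m - int r" ?j "map (\<lambda>i. m - int i + int (part lam i)) [0..<r]"]
      by (simp add: b_wedge_def)
  qed
  finally show "beta_contract ?x n = z_power (- 1) (apply_coeffwise R_inv (bar_minus ?x)) n"
    by (simp add: beta_contract_def fock_contract_eq z_power_def)
qed

theorem proposition6p13:
  fixes m :: int and lam :: "nat list"
  assumes "is_partition lam"
  shows "beta_contract (fock_basis m lam) =
           z_power (-1) (apply_coeffwise R_inv
             (apply_coeffwise (\<lambda>u. series_z (fock_sigma_plus_bar u))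
               (series_zinv (fock_sigma_minus (fock_basis m lam)))))
       \<and> z_power (-1) (apply_coeffwise R_inv
             (apply_coeffwise (\<lambda>u. series_z (fock_sigma_plus_bar u))
               (series_zinv (fock_sigma_minus (fock_basis m lam))))) =
         z_power (-1) (apply_coeffwise R_inv
             (apply_coeffwise E_act
               (series_zinv (fock_sigma_minus (fock_basis m lam)))))"
proof -
  \<comment> \<open>E(z) acts as the inverse of sigma_+(z) on every vector, so the two composites
    coincide as expressions.\<close>
  have E: "E_act = (\<lambda>u. series_z (fock_sigma_plus_bar u))" by (rule ext) (rule E_act_eq)
  show ?thesis unfolding E apply_sigma_bar by (simp only: beta_contract_fock_basis simp_thms)
qed

end
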